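(* Let $G$ be a finite group, $H \le G$ a subgroup, and $w$ an irreducible weight on $G$. The following are equivalent: (i) the left-invariant random walk driven by $w$ lumps weakly to $G/H$ (that is, $\mathrm{MC}(\alpha,w)$ lumps weakly to $G/H$ for some initial distribution $\alpha$); (ii) $\mathrm{MC}(\eta_G,w)$ lumps weakly to $G/H$; (iii) $L_w(1-\eta_H)w\eta_H = 0$; (iv) the left-invariant random walk driven by $w$ lumps weakly to $G/H$ with stable ideal $L_w$.
   Context: A weight on $G$ is a function $w : G \to \mathbb{R}_{\ge 0}$ that is not identically zero; write $w(K) = \sum_{g\in K} w(g)$. Functions $x: G \to \mathbb{C}$ are identified with elements $\sum_g x(g) g \in \mathbb{C}[G]$. The weight $w$ is irreducible if its support generates $G$. $\mathrm{MC}(\alpha,w)$ is the time-homogeneous Markov chain $(X_t)_{t\ge 0}$ on $G$ with $X_0$ distributed as $\alpha$ and $\mathbb{P}[X_{t+1} = xg \mid X_t = x] = w(g)/w(G)$. It lumps weakly to $G/H$ if $(X_tH)_{t\ge 0}$ is a time-homogeneous Markov chain on the set $G/H$ of left cosets. For a non-empty $K \subseteq G$, $\eta_K = |K|^{-1}\sum_{g\in K} g$. $E^\bullet(H)$ is the set of idempotents $e\in\mathbb{C}[H]$ with $\eta_H e = \eta_H$. For a left ideal $L = \mathbb{C}[G]e$ with $e \in E^\bullet(H)$, the walk driven by $w$ lumps weakly to $G/H$ with stable ideal $L$ if $ew(1-e)=0$ and $(e-\eta_H)w\eta_H = 0$ (equivalently $Lw\subseteq L$ and $L(1-\eta_H)w\eta_H=0$,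 so this depends only on $L$). Let $\pi_H : \mathbb{C}[G]\to\mathbb{C}[H]$ be the projection $\sum_{g\in G} x(g) g \mapsto \sum_{g\in H} x(g) g$. A left ideal $L$ of $\mathbb{C}[G]$ is induced if $\pi_H(L)\subseteq L$. A Gurvits--Ledoux ideal for $w$ is an induced left ideal $L$ with $\eta_G\in L$ and $Lw\subseteq L$; every such ideal has the form $\mathbb{C}[G]e$ with $e\in E^\bullet(H)$. $L_w$ denotes the intersection of all Gurvits--Ledoux ideals for $w$ (the minimal Gurvits--Ledoux ideal). *)

theory Defs
  imports
    "HOL-Probability.Probability"
    "HOL-Algebra.Left_Coset"
    "HOL-Algebra.Generated_Groups"
    "HOL-Algebra.Ideal"
begin

section \<open>Weights\<close>

definition weight :: "('a, 'b) monoid_scheme \<Rightarrow> ('a \<Rightarrow> real) \<Rightarrow> bool" where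
  "weight G w \<longleftrightarrow> (\<forall>g\<in>carrier G. 0 \<le> w g) \<and> (\<exists>g\<in>carrier G. w g \<noteq> 0)"

definition irreducible_weight :: "('a, 'b) monoid_scheme \<Rightarrow> ('a \<Rightarrow> real) \<Rightarrow> bool" where
  "irreducible_weight G w \<longleftrightarrow>
     weight G w \<and> generate G {g \<in> carrier G. w g \<noteq> 0} = carrier G"

definition distribution_on :: "'s set \<Rightarrow> ('s \<Rightarrow> real) \<Rightarrow> bool" where
  "distribution_on S \<alpha> \<longleftrightarrow> (\<forall>x\<in>S. 0 \<le> \<alpha> x) \<and> (\<Sum>x\<in>S. \<alpha> x) = 1"

text \<open>
  The element \<open>\<eta>\<^sub>K\<close>.  It is polymorphic because it serves both as a real-valued
  probability distribution and as an element of the complex group algebra.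
\<close>

definition eta :: "'a set \<Rightarrow> 'a \<Rightarrow> 'k::real_field" where
  "eta K = (\<lambda>g. if g \<in> K then 1 / of_nat (card K) else 0)"


section \<open>Time-homogeneous Markov chains and weak lumping\<close>

text \<open>
  The process \<open>X\<close>, defined on the sample space \<open>M\<close>, is a time-homogeneous Markov chain on the
  finite state space \<open>S\<close> with transition matrix \<open>P\<close>.
\<close>

definition markov_chain ::
  "'m measure \<Rightarrow> 's set \<Rightarrow> ('s \<Rightarrow> 's \<Rightarrow> real) \<Rightarrow> (nat \<Rightarrow> 'm \<Rightarrow> 's) \<Rightarrow> bool" where
  "markov_chain M S P X \<longleftrightarrow>
     prob_space M \<and>
     (\<forall>t. X t \<in> measurable M (count_space S)) \<and>
     (\<forall>x\<in>S. distribution_on S (P x)) \<and>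
     (\<forall>t xs y. (\<forall>i\<le>t. xs i \<in> S) \<longrightarrow> y \<in> S \<longrightarrow>
        \<P>(\<omega> in M. \<forall>i\<le>t. X i \<omega> = xs i) \<noteq> 0 \<longrightarrow>
        \<P>(\<omega> in M. X (Suc t) \<omega> = y \<bar> \<forall>i\<le>t. X i \<omega> = xs i) = P (xs t) y)"

text \<open>\<open>X\<close> is a realisation of \<open>MC(\<alpha>, w)\<close> on the sample space \<open>M\<close>.\<close>

definition random_walk ::
  "('a, 'b) monoid_scheme \<Rightarrow> ('a \<Rightarrow> real) \<Rightarrow> ('a \<Rightarrow> real) \<Rightarrow> 'm measure \<Rightarrow> (nat \<Rightarrow> 'm \<Rightarrow> 'a) \<Rightarrow> bool" where
  "random_walk G \<alpha> w M X \<longleftrightarrow>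
     markov_chain M (carrier G)
       (\<lambda>x y. w (inv\<^bsub>G\<^esub> x \<otimes>\<^bsub>G\<^esub> y) / (\<Sum>g\<in>carrier G. w g)) X \<and>
     (\<forall>x\<in>carrier G. \<P>(\<omega> in M. X 0 \<omega> = x) = \<alpha> x)"

definition lumped_markov ::
  "('a, 'b) monoid_scheme \<Rightarrow> 'a set \<Rightarrow> 'm measure \<Rightarrow> (nat \<Rightarrow> 'm \<Rightarrow> 'a) \<Rightarrow> bool" where
  "lumped_markov G H M X \<longleftrightarrow>
     (\<exists>Q. markov_chain M (lcosets\<^bsub>G\<^esub> H) Q (\<lambda>t \<omega>. X t \<omega> <#\<^bsub>G\<^esub> H))"

text \<open>
  Lumping depends only on the law of the chain.  The definition quantifies over all realisations
  on probability spaces over the type of sequences; the lemmas \<open>random_walk_exists\<close> and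
  \<open>lumps_weakly_iff\<close> below show that this quantification is not vacuous, and
  that any single realisation, on a sample space of any type, decides it.
\<close>

definition lumps_weakly ::
  "('a, 'b) monoid_scheme \<Rightarrow> 'a set \<Rightarrow> ('a \<Rightarrow> real) \<Rightarrow> ('a \<Rightarrow> real) \<Rightarrow> bool" where
  "lumps_weakly G H \<alpha> w \<longleftrightarrow>
     (\<forall>(M :: (nat \<Rightarrow> 'a) measure) X. random_walk G \<alpha> w M X \<longrightarrow> lumped_markov G H M X)"

definition walk_lumps_weakly ::
  "('a, 'b) monoid_scheme \<Rightarrow> 'a set \<Rightarrow> ('a \<Rightarrow> real) \<Rightarrow> bool" where
  "walk_lumps_weakly G H w \<longleftrightarrow>
     (\<exists>\<alpha>. distribution_on (carrier G) \<alpha> \<and> lumps_weakly G H \<alpha> w)"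


lemma lcosets_finite: "finite (carrier G) \<Longrightarrow> finite (lcosets\<^bsub>G\<^esub> H)"
  by (auto simp: LCOSETS_def)

lemma lcosets_memI: "x \<in> carrier G \<Longrightarrow> x <#\<^bsub>G\<^esub> H \<in> lcosets\<^bsub>G\<^esub> H"
  by (auto simp: LCOSETS_def)

lemma path_event_sets:
  fixes t :: nat
  assumes X: "\<And>t. X t \<in> measurable M (count_space S)" and xs: "\<forall>i\<le>t. xs i \<in> S"
  shows "{\<omega> \<in> space M. \<forall>i\<le>t. X i \<omega> = xs i} \<in> sets M"
proof -
  have single: "{\<omega> \<in> space M. X i \<omega> = xs i} \<in> sets M" if "i \<le> t" for i
  proof -
    have "X i -` {xs i} \<inter> space M \<in> sets M"
      using xs that by (intro measurable_sets[OF X]) auto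
    also have "X i -` {xs i} \<inter> space M = {\<omega> \<in> space M. X i \<omega> = xs i}" by auto
    finally show ?thesis .
  qed
  have "{\<omega> \<in> space M. \<forall>i\<in>{..t}. X i \<omega> = xs i} \<in> sets M"
    by (intro sets.sets_Collect_finite_All single) auto
  then show ?thesis by (simp only: Ball_def atMost_iff)
qed

lemma markov_chain_path_prob:
  assumes mc: "markov_chain M S P X" and xs: "\<forall>i\<le>t. xs i \<in> S"
  shows "\<P>(\<omega> in M. \<forall>i\<le>t. X i \<omega> = xs i) =
         \<P>(\<omega> in M. X 0 \<omega> = xs 0) * (\<Prod>i<t. P (xs i) (xs (Suc i)))"
  using xs
proof (induction t)
  case 0
  then show ?case by simp
next
  case (Suc t)
  interpret prob_space M using mc by (simp add: markov_chain_def)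
  have X: "\<And>t. X t \<in> measurable M (count_space S)"
    using mc by (simp add: markov_chain_def)
  have IH: "\<P>(\<omega> in M. \<forall>i\<le>t. X i \<omega> = xs i) =
         \<P>(\<omega> in M. X 0 \<omega> = xs 0) * (\<Prod>i<t. P (xs i) (xs (Suc i)))"
    using Suc by simp
  have split: "{\<omega> \<in> space M. \<forall>i\<le>Suc t. X i \<omega> = xs i} =
     {\<omega> \<in> space M. X (Suc t) \<omega> = xs (Suc t) \<and> (\<forall>i\<le>t. X i \<omega> = xs i)}"
    by (auto simp: le_Suc_eq)
  show ?case
  proof (cases "\<P>(\<omega> in M. \<forall>i\<le>t. X i \<omega> = xs i) = 0")
    case True
    have "\<P>(\<omega> in M. \<forall>i\<le>Suc t. X i \<omega> = xs i) \<le> \<P>(\<omega> in M. \<forall>i\<le>t. X i \<omega> = xs i)"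
      using Suc.prems by (intro finite_measure_mono path_event_sets[OF X]) auto
    then have "\<P>(\<omega> in M. \<forall>i\<le>Suc t. X i \<omega> = xs i) = 0"
      using True by (simp add: measure_le_0_iff)
    then show ?thesis using True IH by auto
  next
    case False
    have "\<P>(\<omega> in M. X (Suc t) \<omega> = xs (Suc t) \<bar> \<forall>i\<le>t. X i \<omega> = xs i) = P (xs t) (xs (Suc t))"
      using mc Suc.prems False unfolding markov_chain_def by auto
    then have "\<P>(\<omega> in M. \<forall>i\<le>Suc t. X i \<omega> = xs i) =
        P (xs t) (xs (Suc t)) * \<P>(\<omega> in M. \<forall>i\<le>t. X i \<omega> = xs i)"
      using False unfolding split cond_prob_def by (simp add: field_simps)
    then show ?thesis using IH by simp
  qed
qed

lemma lumped_path_prob: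
  fixes t :: nat
  assumes fin: "finite (carrier G)" and M: "prob_space M"
    and X: "\<And>t. X t \<in> measurable M (count_space (carrier G))"
  shows "\<P>(\<omega> in M. \<forall>i\<le>t. X i \<omega> <#\<^bsub>G\<^esub> H = c i) =
    (\<Sum>p\<in>{p \<in> PiE {..t} (\<lambda>_. carrier G). \<forall>i\<le>t. p i <#\<^bsub>G\<^esub> H = c i}.
       \<P>(\<omega> in M. \<forall>i\<le>t. X i \<omega> = p i))"
proof -
  interpret prob_space M by fact
  define I where "I = {p \<in> PiE {..t} (\<lambda>_. carrier G). \<forall>i\<le>t. p i <#\<^bsub>G\<^esub> H = c i}"
  define A where "A = (\<lambda>p. {\<omega> \<in> space M. \<forall>i\<le>t. X i \<omega> = p i})"
  define B where "B = {\<omega> \<in> space M. \<forall>i\<le>t. X i \<omega> <#\<^bsub>G\<^esub> H = c i}"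
  have XG: "X i \<omega> \<in> carrier G" if "\<omega> \<in> space M" for i \<omega>
    using measurable_space[OF X that] by simp
  have "B \<subseteq> (\<Union>p\<in>I. A p)"
  proof
    fix \<omega> assume w: "\<omega> \<in> B"
    define p where "p = restrict (\<lambda>i. X i \<omega>) {..t}"
    have p: "p i = X i \<omega>" if "i \<le> t" for i using that by (simp add: p_def)
    have "p \<in> PiE {..t} (\<lambda>_. carrier G)"
      unfolding p_def restrict_PiE_iff using w XG by (simp add: B_def)
    then have "p \<in> I" using w p by (simp add: I_def B_def)
    moreover have "\<omega> \<in> A p" using w p by (simp add: A_def B_def)
    ultimately show "\<omega> \<in> (\<Union>p\<in>I. A p)" by blast
  qed
  moreover have "A p \<subseteq> B" if "p \<in> I" for p
    using that by (simp add: A_def B_def I_def subset_iff)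
  ultimately have "B = (\<Union>p\<in>I. A p)" by blast
  moreover have "prob (\<Union>p\<in>I. A p) = (\<Sum>p\<in>I. prob (A p))"
  proof (rule finite_measure_finite_Union)
    show "finite I"
      by (rule finite_subset[of _ "PiE {..t} (\<lambda>_. carrier G)"])
        (use fin in \<open>simp_all add: I_def finite_PiE\<close>)
    have "A p \<in> events" if "p \<in> I" for p
    proof -
      have "\<forall>i\<le>t. p i \<in> carrier G" using that by (simp add: I_def PiE_iff)
      then show ?thesis unfolding A_def by (rule path_event_sets[OF X])
    qed
    then show "A ` I \<subseteq> events" by blast
    have "A p \<inter> A q = {}" if "p \<in> I" "q \<in> I" "p \<noteq> q" for p q
    proof -
      have "\<exists>i\<in>{..t}. p i \<noteq> q i"
      proof (rule ccontr)
        assume "\<not> ?thesis"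
        then have "p = q"
          using that(1,2) unfolding I_def
          by (intro PiE_ext[of p "{..t}" "\<lambda>_. carrier G" q]) simp_all
        with that show False by simp
      qed
      then obtain i where i: "i \<le> t" "p i \<noteq> q i" by blast
      have "\<omega> \<notin> A q" if "\<omega> \<in> A p" for \<omega>
        using that i by (simp add: A_def) metis
      then show ?thesis by blast
    qed
    then show "disjoint_family_on A I"
      by (simp add: disjoint_family_on_def)
  qed
  ultimately have "prob B = (\<Sum>p\<in>I. prob (A p))" by simp
  then show ?thesis by (simp only: A_def B_def I_def)
qed

lemma lumped_markov_transfer:
  assumes fin: "finite (carrier G)"
    and rw: "random_walk G \<alpha> w M X" and rw': "random_walk G \<alpha> w M' X'"
    and lump: "lumped_markov G H M X"
  shows "lumped_markov G H M' X'"
proof -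
  let ?S = "lcosets\<^bsub>G\<^esub> H"
  have mc: "markov_chain M (carrier G)
       (\<lambda>x y. w (inv\<^bsub>G\<^esub> x \<otimes>\<^bsub>G\<^esub> y) / (\<Sum>g\<in>carrier G. w g)) X"
    and mc': "markov_chain M' (carrier G)
       (\<lambda>x y. w (inv\<^bsub>G\<^esub> x \<otimes>\<^bsub>G\<^esub> y) / (\<Sum>g\<in>carrier G. w g)) X'"
    using rw rw' by (auto simp: random_walk_def)
  have M: "prob_space M" and M': "prob_space M'"
    and X: "\<And>t. X t \<in> measurable M (count_space (carrier G))"
    and X': "\<And>t. X' t \<in> measurable M' (count_space (carrier G))"
    using mc mc' by (auto simp: markov_chain_def)
  have path: "\<P>(\<omega> in M. \<forall>i\<le>t. X i \<omega> = p i) = \<P>(\<omega> in M'. \<forall>i\<le>t. X' i \<omega> = p i)"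
    if p: "\<forall>i\<le>t. p i \<in> carrier G" for p t
  proof -
    have "\<P>(\<omega> in M. X 0 \<omega> = p 0) = \<P>(\<omega> in M'. X' 0 \<omega> = p 0)"
      using rw rw' p by (auto simp: random_walk_def)
    then show ?thesis
      by (simp only: markov_chain_path_prob[OF mc p] markov_chain_path_prob[OF mc' p])
  qed
  have eq: "\<P>(\<omega> in M. \<forall>i\<le>t. X i \<omega> <#\<^bsub>G\<^esub> H = c i) =
            \<P>(\<omega> in M'. \<forall>i\<le>t. X' i \<omega> <#\<^bsub>G\<^esub> H = c i)" for c t
    unfolding lumped_path_prob[OF fin M X] lumped_path_prob[OF fin M' X']
    by (intro sum.cong refl path) auto
  have Suc_event: "{\<omega> \<in> space N. Y (Suc t) \<omega> <#\<^bsub>G\<^esub> H = y \<and> (\<forall>i\<le>t. Y i \<omega> <#\<^bsub>G\<^esub> H = c i)} =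
      {\<omega> \<in> space N. \<forall>i\<le>Suc t. Y i \<omega> <#\<^bsub>G\<^esub> H = (c(Suc t := y)) i}"
    for N :: "'x measure" and Y c t y
    by (auto simp: le_Suc_eq)
  have cond: "\<P>(\<omega> in M. X (Suc t) \<omega> <#\<^bsub>G\<^esub> H = y \<bar> \<forall>i\<le>t. X i \<omega> <#\<^bsub>G\<^esub> H = c i) =
              \<P>(\<omega> in M'. X' (Suc t) \<omega> <#\<^bsub>G\<^esub> H = y \<bar> \<forall>i\<le>t. X' i \<omega> <#\<^bsub>G\<^esub> H = c i)" for c t y
    unfolding cond_prob_def Suc_event eq ..
  have meas: "(\<lambda>\<omega>. X' t \<omega> <#\<^bsub>G\<^esub> H) \<in> measurable M' (count_space ?S)" for t
    by (rule measurable_compose[OF X']) (auto intro: lcosets_memI)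
  from lump obtain Q where Q: "markov_chain M ?S Q (\<lambda>t \<omega>. X t \<omega> <#\<^bsub>G\<^esub> H)"
    by (auto simp: lumped_markov_def)
  have "markov_chain M' ?S Q (\<lambda>t \<omega>. X' t \<omega> <#\<^bsub>G\<^esub> H)"
    using Q meas M' unfolding markov_chain_def eq cond by auto
  then show ?thesis by (auto simp: lumped_markov_def)
qed

lemma random_walk_exists:
  fixes G :: "('a, 'b) monoid_scheme"
  assumes G: "group G" and fin: "finite (carrier G)" and w: "weight G w"
    and \<alpha>: "distribution_on (carrier G) \<alpha>"
  shows "\<exists>(M :: (nat \<Rightarrow> 'a) measure) X. random_walk G \<alpha> w M X"
proof -
  interpret G: group G by fact
  define W where "W = (\<Sum>g\<in>carrier G. w g)"
  have w0: "\<And>g. g \<in> carrier G \<Longrightarrow> 0 \<le> w g" using w by (auto simp: weight_def)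
  have W: "W > 0"
  proof -
    from w obtain g where g: "g \<in> carrier G" "w g \<noteq> 0" by (auto simp: weight_def)
    then have "0 < w g" using w0[of g] by simp
    then show ?thesis unfolding W_def using fin w0 g by (intro sum_pos2[where i = g]) auto
  qed
  define f where "f = (\<lambda>n g. if n = (0::nat) then \<alpha> g else w g / W)"
  have f0: "0 \<le> f n g" if "g \<in> carrier G" for n g
    using that w0 W \<alpha> by (auto simp: f_def distribution_on_def)
  have f1: "(\<Sum>g\<in>carrier G. f n g) = 1" for n
    using W \<alpha> by (cases n) (auto simp: f_def distribution_on_def W_def sum_divide_distrib[symmetric])
  define N where "N = (\<lambda>n. point_measure (carrier G) (\<lambda>g. ennreal (f n g)))"
  have spN: "space (N n) = carrier G" for n by (simp add: N_def space_point_measure)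
  have emN: "emeasure (N n) {g} = ennreal (f n g)" if "g \<in> carrier G" for n g
    using that fin by (simp add: N_def emeasure_point_measure_finite)
  have psN: "prob_space (N n)" for n
  proof
    have "emeasure (N n) (space (N n)) = (\<Sum>g\<in>carrier G. ennreal (f n g))"
      using fin by (simp add: spN, simp add: N_def emeasure_point_measure_finite)
    also have "\<dots> = ennreal (\<Sum>g\<in>carrier G. f n g)" using f0 by (intro sum_ennreal) auto
    finally show "emeasure (N n) (space (N n)) = 1" by (simp add: f1)
  qed
  interpret N: product_prob_space N UNIV by (intro product_prob_spaceI psN)
  define M where "M = PiM UNIV N"
  interpret P: prob_space M unfolding M_def by (rule prob_space_PiM) (rule psN)
  define X where "X = rec_nat (\<lambda>\<omega>. \<omega> 0) (\<lambda>t Y \<omega>. Y \<omega> \<otimes>\<^bsub>G\<^esub> \<omega> (Suc t))"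
  have X0: "X 0 \<omega> = \<omega> 0" and XS: "X (Suc t) \<omega> = X t \<omega> \<otimes>\<^bsub>G\<^esub> \<omega> (Suc t)"
    for t and \<omega> :: "nat \<Rightarrow> 'a"
    by (simp_all add: X_def)
  have comp: "(\<lambda>\<omega>. \<omega> n) \<in> measurable M (count_space (carrier G))" for n
  proof -
    have "(\<lambda>\<omega>. \<omega> n) \<in> measurable M (N n)"
      unfolding M_def by (rule measurable_component_singleton) simp
    moreover have "sets (N n) = sets (count_space (carrier G))"
      by (simp add: N_def sets_point_measure)
    ultimately show ?thesis
      using measurable_cong_sets[OF refl] by blast
  qed
  have comp_in: "\<omega> n \<in> carrier G" if "\<omega> \<in> space M" for \<omega> n
    using measurable_space[OF comp that] by simp
  have X: "X t \<in> measurable M (count_space (carrier G))" for t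
  proof (induction t)
    case 0
    then show ?case using comp[of 0] by (simp add: X_def)
  next
    case (Suc t)
    have "(\<lambda>\<omega>. x \<otimes>\<^bsub>G\<^esub> \<omega> (Suc t)) \<in> measurable M (count_space (carrier G))"
      if "x \<in> carrier G" for x
      by (rule measurable_compose[OF comp]) (use that in auto)
    then have "(\<lambda>\<omega>. X t \<omega> \<otimes>\<^bsub>G\<^esub> \<omega> (Suc t)) \<in> measurable M (count_space (carrier G))"
      by (rule measurable_compose_countable'[where I = "carrier G" and g = "X t"
          and f = "\<lambda>x \<omega>. x \<otimes>\<^bsub>G\<^esub> \<omega> (Suc t)"]) (use Suc fin in \<open>simp_all add: countable_finite\<close>)
    moreover have "X (Suc t) = (\<lambda>\<omega>. X t \<omega> \<otimes>\<^bsub>G\<^esub> \<omega> (Suc t))"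
      by (simp add: X_def)
    ultimately show ?case by simp
  qed
  have XG: "X t \<omega> \<in> carrier G" if "\<omega> \<in> space M" for t \<omega>
    using measurable_space[OF X that] by simp
  define d where "d = (\<lambda>xs i. case i of 0 \<Rightarrow> xs 0 | Suc j \<Rightarrow> inv\<^bsub>G\<^esub> (xs j) \<otimes>\<^bsub>G\<^esub> xs (Suc j))"
  have ev: "(\<forall>i\<le>t. X i \<omega> = xs i) \<longleftrightarrow> (\<forall>i\<le>t. \<omega> i = d xs i)"
    if "\<forall>i\<le>t. xs i \<in> carrier G" "\<omega> \<in> space M" for t xs \<omega>
    using that(1)
  proof (induction t)
    case 0
    then show ?case by (simp add: X0 d_def)
  next
    case (Suc t)
    have "X (Suc t) \<omega> = xs (Suc t) \<longleftrightarrow> \<omega> (Suc t) = d xs (Suc t)" if "X t \<omega> = xs t"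
      using Suc.prems that comp_in[OF \<open>\<omega> \<in> space M\<close>] 
      by (auto simp: XS d_def G.m_assoc[symmetric] G.inv_solve_left)
    with Suc show ?case by (auto simp: le_Suc_eq)
  qed
  have d_in: "d xs i \<in> carrier G" if "\<forall>i\<le>t. xs i \<in> carrier G" "i \<le> t" for xs i t
    using that by (auto simp: d_def split: nat.split)
  have path: "\<P>(\<omega> in M. \<forall>i\<le>t. X i \<omega> = xs i) = (\<Prod>i\<le>t. f i (d xs i))"
    if xs: "\<forall>i\<le>t. xs i \<in> carrier G" for t xs
  proof -
    have "{\<omega> \<in> space M. \<forall>i\<le>t. X i \<omega> = xs i} = {\<omega> \<in> space M. \<forall>i\<in>{..t}. \<omega> i \<in> {d xs i}}"
      using ev[OF xs] by auto
    moreover have "emeasure M {\<omega> \<in> space M. \<forall>i\<in>{..t}. \<omega> i \<in> {d xs i}} =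
        (\<Prod>i\<in>{..t}. emeasure (N i) {d xs i})"
      unfolding M_def
    proof (rule N.emeasure_PiM_Collect)
      show "{d xs i} \<in> sets (N i)" if "i \<in> {..t}" for i
        using d_in[OF xs] that by (simp add: N_def sets_point_measure)
    qed auto
    moreover have "(\<Prod>i\<in>{..t}. emeasure (N i) {d xs i}) = (\<Prod>i\<in>{..t}. ennreal (f i (d xs i)))"
      using d_in[OF xs] by (intro prod.cong refl emN) auto
    moreover have "\<dots> = ennreal (\<Prod>i\<in>{..t}. f i (d xs i))"
      using d_in[OF xs] f0 by (intro prod_ennreal) auto
    ultimately have "emeasure M {\<omega> \<in> space M. \<forall>i\<le>t. X i \<omega> = xs i} =
        ennreal (\<Prod>i\<le>t. f i (d xs i))"
      by (simp only:)
    moreover have "0 \<le> (\<Prod>i\<le>t. f i (d xs i))"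
      using d_in[OF xs] f0 by (intro prod_nonneg) auto
    ultimately show ?thesis by (simp only: measure_def enn2real_ennreal)
  qed
  have "random_walk G \<alpha> w M X"
    unfolding random_walk_def markov_chain_def
  proof (intro conjI allI ballI impI)
    show "prob_space M" by (rule P.prob_space_axioms)
    show "X t \<in> measurable M (count_space (carrier G))" for t by (rule X)
    show "distribution_on (carrier G) (\<lambda>y. w (inv\<^bsub>G\<^esub> x \<otimes>\<^bsub>G\<^esub> y) / (\<Sum>g\<in>carrier G. w g))"
      if x: "x \<in> carrier G" for x
    proof -
      have "(\<Sum>y\<in>carrier G. w (inv\<^bsub>G\<^esub> x \<otimes>\<^bsub>G\<^esub> y)) = W" unfolding W_def
        by (rule sum.reindex_bij_witness[where i = "\<lambda>g. x \<otimes>\<^bsub>G\<^esub> g" and j = "\<lambda>y. inv\<^bsub>G\<^esub> x \<otimes>\<^bsub>G\<^esub> y"])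
          (use x in \<open>auto simp: G.m_assoc[symmetric]\<close>)
      then show ?thesis
        using x w0 W by (auto simp: distribution_on_def W_def[symmetric] sum_divide_distrib[symmetric])
    qed
    show "\<P>(\<omega> in M. X 0 \<omega> = x) = \<alpha> x" if "x \<in> carrier G" for x
      using path[of 0 "\<lambda>_. x"] that by (simp add: f_def d_def)
    fix t xs y
    assume xs: "\<forall>i\<le>t. xs i \<in> carrier G" and y: "y \<in> carrier G"
      and nz: "\<P>(\<omega> in M. \<forall>i\<le>t. X i \<omega> = xs i) \<noteq> 0"
    let ?ys = "xs(Suc t := y)"
    have ys: "\<forall>i\<le>Suc t. ?ys i \<in> carrier G" using xs y by auto
    have "{\<omega> \<in> space M. X (Suc t) \<omega> = y \<and> (\<forall>i\<le>t. X i \<omega> = xs i)} =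
          {\<omega> \<in> space M. \<forall>i\<le>Suc t. X i \<omega> = ?ys i}"
      by (auto simp: le_Suc_eq)
    moreover have "(\<Prod>i\<le>t. f i (d ?ys i)) = (\<Prod>i\<le>t. f i (d xs i))"
      by (intro prod.cong refl) (auto simp: d_def split: nat.split)
    moreover have "f (Suc t) (d ?ys (Suc t)) = w (inv\<^bsub>G\<^esub> xs t \<otimes>\<^bsub>G\<^esub> y) / W"
      by (simp add: f_def d_def)
    ultimately have num: "\<P>(\<omega> in M. X (Suc t) \<omega> = y \<and> (\<forall>i\<le>t. X i \<omega> = xs i)) =
        (\<Prod>i\<le>t. f i (d xs i)) * (w (inv\<^bsub>G\<^esub> xs t \<otimes>\<^bsub>G\<^esub> y) / W)"
      using path[OF ys] by (simp only: prod.atMost_Suc)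
    have "(\<Prod>i\<le>t. f i (d xs i)) \<noteq> 0" using nz unfolding path[OF xs] .
    then show "\<P>(\<omega> in M. X (Suc t) \<omega> = y \<bar> \<forall>i\<le>t. X i \<omega> = xs i) =
        w (inv\<^bsub>G\<^esub> xs t \<otimes>\<^bsub>G\<^esub> y) / (\<Sum>g\<in>carrier G. w g)"
      unfolding cond_prob_def W_def[symmetric] num path[OF xs]
      by (rule nonzero_mult_div_cancel_left)
  qed
  then show ?thesis by blast
qed

lemma lumps_weakly_iff:
  fixes G :: "('a, 'b) monoid_scheme"
  assumes "group G" "finite (carrier G)" "weight G w" "distribution_on (carrier G) \<alpha>"
    and "random_walk G \<alpha> w M X"
  shows "lumps_weakly G H \<alpha> w \<longleftrightarrow> lumped_markov G H M X"
proof
  assume lump: "lumps_weakly G H \<alpha> w"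
  obtain M' :: "(nat \<Rightarrow> 'a) measure" and X' where rw: "random_walk G \<alpha> w M' X'"
    using random_walk_exists[OF assms(1-4)] by blast
  with lump have "lumped_markov G H M' X'"
    by (simp add: lumps_weakly_def)
  then show "lumped_markov G H M X"
    by (rule lumped_markov_transfer[OF assms(2) rw assms(5)])
next
  assume "lumped_markov G H M X"
  then show "lumps_weakly G H \<alpha> w"
    unfolding lumps_weakly_def using lumped_markov_transfer[OF assms(2,5)] by blast
qed

lemma distribution_on_eta: "finite K \<Longrightarrow> K \<noteq> {} \<Longrightarrow> distribution_on K (eta K)"
  by (simp add: distribution_on_def eta_def)


section \<open>The group algebra\<close>

text \<open>
  Elements of \<open>\<complex>[G]\<close> are the functions that vanish outside the carrier of \<open>G\<close>; the product
  is convolution.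
\<close>

definition group_algebra :: "('a, 'b) monoid_scheme \<Rightarrow> ('a \<Rightarrow> complex) ring" where
  "group_algebra G =
     \<lparr>carrier = {x. \<forall>g. g \<notin> carrier G \<longrightarrow> x g = 0},
      monoid.mult = (\<lambda>x y g. if g \<in> carrier G
                       then \<Sum>h\<in>carrier G. x h * y (inv\<^bsub>G\<^esub> h \<otimes>\<^bsub>G\<^esub> g) else 0),
      one = (\<lambda>g. if g = \<one>\<^bsub>G\<^esub> then 1 else 0),
      zero = (\<lambda>_. 0),
      add = (\<lambda>x y g. x g + y g)\<rparr>"

lemma ring_group_algebra:
  assumes G: "group G" and fin: "finite (carrier G)"
  shows "ring (group_algebra G)"
proof -
  interpret G: group G by fact
  have shift: "(\<Sum>h\<in>carrier G. F h) = (\<Sum>h\<in>carrier G. F (a \<otimes>\<^bsub>G\<^esub> h))"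
    if "a \<in> carrier G" for F :: "'a \<Rightarrow> complex" and a
    by (rule sum.reindex_bij_witness[where j = "\<lambda>h. inv\<^bsub>G\<^esub> a \<otimes>\<^bsub>G\<^esub> h" and i = "\<lambda>h. a \<otimes>\<^bsub>G\<^esub> h"])
      (use that in \<open>auto simp: G.m_assoc[symmetric]\<close>)
  show ?thesis
  proof (intro ringI abelian_groupI monoidI)
    fix x assume x: "x \<in> carrier (group_algebra G)"
    show "\<exists>y\<in>carrier (group_algebra G). y \<oplus>\<^bsub>group_algebra G\<^esub> x = \<zero>\<^bsub>group_algebra G\<^esub>"
      using x by (intro bexI[of _ "\<lambda>g. - x g"]) (auto simp: group_algebra_def)
    show "\<one>\<^bsub>group_algebra G\<^esub> \<otimes>\<^bsub>group_algebra G\<^esub> x = x"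
      using x fin by (auto simp: group_algebra_def fun_eq_iff if_distrib[of "\<lambda>z. z * _"] cong: if_cong)
    have "(\<Sum>h\<in>carrier G. x h * (if inv\<^bsub>G\<^esub> h \<otimes>\<^bsub>G\<^esub> g = \<one>\<^bsub>G\<^esub> then 1 else 0)) = x g"
      if g: "g \<in> carrier G" for g
    proof -
      have "(\<Sum>h\<in>carrier G. x h * (if inv\<^bsub>G\<^esub> h \<otimes>\<^bsub>G\<^esub> g = \<one>\<^bsub>G\<^esub> then 1 else 0)) =
            (\<Sum>h\<in>carrier G. if h = g then x h else 0)"
      proof (intro sum.cong refl)
        fix h assume h: "h \<in> carrier G"
        have "inv\<^bsub>G\<^esub> h \<otimes>\<^bsub>G\<^esub> g = \<one>\<^bsub>G\<^esub> \<longleftrightarrow> h = g"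
          using g h by (metis G.inv_closed G.inv_equality G.inv_inv G.l_inv)
        then show "x h * (if inv\<^bsub>G\<^esub> h \<otimes>\<^bsub>G\<^esub> g = \<one>\<^bsub>G\<^esub> then 1 else 0) = (if h = g then x h else 0)"
          by simp
      qed
      then show ?thesis using fin g by simp
    qed
    then show "x \<otimes>\<^bsub>group_algebra G\<^esub> \<one>\<^bsub>group_algebra G\<^esub> = x"
      using x by (auto simp: group_algebra_def fun_eq_iff)
  next
    fix x y z
    show "x \<otimes>\<^bsub>group_algebra G\<^esub> y \<otimes>\<^bsub>group_algebra G\<^esub> z =
          x \<otimes>\<^bsub>group_algebra G\<^esub> (y \<otimes>\<^bsub>group_algebra G\<^esub> z)"
    proof -
      have "(\<Sum>h\<in>carrier G. (\<Sum>k\<in>carrier G. x k * y (inv\<^bsub>G\<^esub> k \<otimes>\<^bsub>G\<^esub> h)) * z (inv\<^bsub>G\<^esub> h \<otimes>\<^bsub>G\<^esub> g)) =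
            (\<Sum>k\<in>carrier G. x k * (\<Sum>h\<in>carrier G. y h * z (inv\<^bsub>G\<^esub> h \<otimes>\<^bsub>G\<^esub> (inv\<^bsub>G\<^esub> k \<otimes>\<^bsub>G\<^esub> g))))"
        if g: "g \<in> carrier G" for g
      proof -
        have "(\<Sum>h\<in>carrier G. (\<Sum>k\<in>carrier G. x k * y (inv\<^bsub>G\<^esub> k \<otimes>\<^bsub>G\<^esub> h)) * z (inv\<^bsub>G\<^esub> h \<otimes>\<^bsub>G\<^esub> g)) =
              (\<Sum>k\<in>carrier G. x k * (\<Sum>h\<in>carrier G. y (inv\<^bsub>G\<^esub> k \<otimes>\<^bsub>G\<^esub> h) * z (inv\<^bsub>G\<^esub> h \<otimes>\<^bsub>G\<^esub> g)))"
          by (simp add: sum_distrib_left sum_distrib_right mult.assoc)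
            (rule sum.swap)
        also have "\<dots> = (\<Sum>k\<in>carrier G. x k * (\<Sum>h\<in>carrier G. y h * z (inv\<^bsub>G\<^esub> h \<otimes>\<^bsub>G\<^esub> (inv\<^bsub>G\<^esub> k \<otimes>\<^bsub>G\<^esub> g))))"
        proof (rule sum.cong[OF refl])
          fix k assume k: "k \<in> carrier G"
          have "(\<Sum>h\<in>carrier G. y (inv\<^bsub>G\<^esub> k \<otimes>\<^bsub>G\<^esub> h) * z (inv\<^bsub>G\<^esub> h \<otimes>\<^bsub>G\<^esub> g)) =
                (\<Sum>h\<in>carrier G. y h * z (inv\<^bsub>G\<^esub> h \<otimes>\<^bsub>G\<^esub> (inv\<^bsub>G\<^esub> k \<otimes>\<^bsub>G\<^esub> g)))"
            by (subst shift[OF k], intro sum.cong refl)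
              (use k g in \<open>simp add: G.m_assoc[symmetric] G.inv_mult_group\<close>)
          then show "x k * (\<Sum>h\<in>carrier G. y (inv\<^bsub>G\<^esub> k \<otimes>\<^bsub>G\<^esub> h) * z (inv\<^bsub>G\<^esub> h \<otimes>\<^bsub>G\<^esub> g)) =
                x k * (\<Sum>h\<in>carrier G. y h * z (inv\<^bsub>G\<^esub> h \<otimes>\<^bsub>G\<^esub> (inv\<^bsub>G\<^esub> k \<otimes>\<^bsub>G\<^esub> g)))"
            by simp
        qed
        finally show ?thesis .
      qed
      moreover have "inv\<^bsub>G\<^esub> k \<otimes>\<^bsub>G\<^esub> g \<in> carrier G" if "k \<in> carrier G" "g \<in> carrier G" for k g
        using that by simp
      ultimately show ?thesis
        by (auto simp: group_algebra_def fun_eq_iff)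
    qed
  qed (auto simp: group_algebra_def fun_eq_iff algebra_simps sum.distrib)
qed

lemma group_algebra_minus:
  assumes "group G" and "finite (carrier G)"
    and "x \<in> carrier (group_algebra G)" and y: "y \<in> carrier (group_algebra G)"
  shows "x \<ominus>\<^bsub>group_algebra G\<^esub> y = (\<lambda>g. x g - y g)"
proof -
  interpret ring "group_algebra G" by (rule ring_group_algebra) fact+
  have "\<ominus>\<^bsub>group_algebra G\<^esub> y = (\<lambda>g. - y g)"
    by (rule minus_equality) (use y in \<open>auto simp: group_algebra_def\<close>)
  then show ?thesis by (simp add: a_minus_def group_algebra_def)
qed

text \<open>The weight \<open>w\<close> as an element of the group algebra.\<close>

definition weight_elt :: "('a, 'b) monoid_scheme \<Rightarrow> ('a \<Rightarrow> real) \<Rightarrow> 'a \<Rightarrow> complex" where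
  "weight_elt G w = (\<lambda>g. if g \<in> carrier G then complex_of_real (w g) else 0)"

text \<open>The projection \<open>\<pi>\<^sub>H\<close>.\<close>

definition proj :: "'a set \<Rightarrow> ('a \<Rightarrow> complex) \<Rightarrow> 'a \<Rightarrow> complex" where
  "proj H x = (\<lambda>g. if g \<in> H then x g else 0)"

definition left_ideal :: "'c set \<Rightarrow> ('c, 'd) ring_scheme \<Rightarrow> bool" where
  "left_ideal L R \<longleftrightarrow>
     additive_subgroup L R \<and> (\<forall>a\<in>carrier R. \<forall>x\<in>L. a \<otimes>\<^bsub>R\<^esub> x \<in> L)"

text \<open>The set \<open>E\<^sup>\<bullet>(H)\<close>.\<close>

definition E_bullet :: "('a, 'b) monoid_scheme \<Rightarrow> 'a set \<Rightarrow> ('a \<Rightarrow> complex) set" where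
  "E_bullet G H =
     {e. (\<forall>g. g \<notin> H \<longrightarrow> e g = 0) \<and>
         e \<otimes>\<^bsub>group_algebra G\<^esub> e = e \<and>
         eta H \<otimes>\<^bsub>group_algebra G\<^esub> e = eta H}"

definition lumps_weakly_stable ::
  "('a, 'b) monoid_scheme \<Rightarrow> 'a set \<Rightarrow> ('a \<Rightarrow> real) \<Rightarrow> ('a \<Rightarrow> complex) set \<Rightarrow> bool" where
  "lumps_weakly_stable G H w L \<longleftrightarrow>
     (let A = group_algebra G; v = weight_elt G w in
      \<exists>e\<in>E_bullet G H. L = {x \<otimes>\<^bsub>A\<^esub> e | x. x \<in> carrier A} \<and>
        e \<otimes>\<^bsub>A\<^esub> v \<otimes>\<^bsub>A\<^esub> (\<one>\<^bsub>A\<^esub> \<ominus>\<^bsub>A\<^esub> e) = \<zero>\<^bsub>A\<^esub> \<and>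
        (e \<ominus>\<^bsub>A\<^esub> eta H) \<otimes>\<^bsub>A\<^esub> v \<otimes>\<^bsub>A\<^esub> eta H = \<zero>\<^bsub>A\<^esub>)"

definition induced_left_ideal ::
  "('a, 'b) monoid_scheme \<Rightarrow> 'a set \<Rightarrow> ('a \<Rightarrow> complex) set \<Rightarrow> bool" where
  "induced_left_ideal G H L \<longleftrightarrow> left_ideal L (group_algebra G) \<and> proj H ` L \<subseteq> L"

definition gurvits_ledoux_ideal ::
  "('a, 'b) monoid_scheme \<Rightarrow> 'a set \<Rightarrow> ('a \<Rightarrow> real) \<Rightarrow> ('a \<Rightarrow> complex) set \<Rightarrow> bool" where
  "gurvits_ledoux_ideal G H w L \<longleftrightarrow>
     induced_left_ideal G H L \<and> eta (carrier G) \<in> L \<and>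
     (\<forall>x\<in>L. x \<otimes>\<^bsub>group_algebra G\<^esub> weight_elt G w \<in> L)"

definition minimal_GL_ideal ::
  "('a, 'b) monoid_scheme \<Rightarrow> 'a set \<Rightarrow> ('a \<Rightarrow> real) \<Rightarrow> ('a \<Rightarrow> complex) set" where
  "minimal_GL_ideal G H w = \<Inter> {L. gurvits_ledoux_ideal G H w L}"

end

theory Submission
  imports Defs
begin

text \<open>
  Write \<open>v\<close> for \<open>w\<close> as an element of \<open>\<complex>[G]\<close>.  Observing that the walk is in the coset \<open>C\<close>
  restricts its law to \<open>C\<close>, and a step multiplies the law by \<open>v\<close> from the right, so up to
  normalisation the law of the walk on the event that it follows a given path of cosets is
  obtained from the initial law by alternating these two linear maps.  Let \<open>y\<close> be such a law,
  supported on \<open>C\<close>.  The next coset is distributed as from the uniform distribution on \<open>C\<close>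
  exactly if \<open>y(1 - \<eta>\<^sub>H)v\<eta>\<^sub>H = 0\<close>.  Call an initial element lumpable if this holds for all coset
  paths.

  The lumpable elements form an induced left ideal closed under right multiplication by \<open>v\<close>:
  it is left invariant because a left translation permutes the coset paths.  If \<open>\<eta>\<^sub>G\<close> is
  lumpable, it is therefore a Gurvits--Ledoux ideal and contains \<open>L\<^sub>w\<close>, which gives (iii).
  Conversely, every Gurvits--Ledoux ideal contains all laws that coset paths produce from
  \<open>\<eta>\<^sub>G\<close>, so (iii) makes \<open>\<eta>\<^sub>G\<close> lumpable.  This is \<open>minimal_GL_ideal_defect_iff\<close>.

  It remains to compare this with probability.  If \<open>\<eta>\<^sub>G\<close> is lumpable, then the lumped walk from
  \<open>\<eta>\<^sub>G\<close> is visibly Markov.  If the walk lumps from some initial distribution with transition matrix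
  \<open>Q\<close>, then the elements of \<open>\<complex>[G]\<close> that satisfy the Markov identities with this \<open>Q\<close> form a linear
  subspace closed under \<open>v\<close>.  By irreducibility it contains \<open>\<eta>\<^sub>G\<close>
  (\<open>eta_in_invariant_subspace\<close>), whose first step then determines \<open>Q\<close> and shows that \<open>\<eta>\<^sub>G\<close> is lumpable.

  Finally (iii) and (iv) agree because \<open>L\<^sub>w\<close> is generated by an idempotent in \<open>E\<^sup>\<bullet>(H)\<close>
  (\<open>induced_ideal_idempotent\<close>, \<open>lumps_weakly_stable_iff\<close>), which is a form of Maschke's
  theorem: the orthogonal projection of 1 to the ideal gives it.
\<close>

section \<open>Orthogonal projection in finite-dimensional function spaces\<close>

definition linear_subspace :: "('a \<Rightarrow> complex) set \<Rightarrow> bool" where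
  "linear_subspace V \<longleftrightarrow>
     (\<lambda>_. 0) \<in> V \<and> (\<forall>x\<in>V. \<forall>y\<in>V. \<forall>c. (\<lambda>g. x g + c * y g) \<in> V)"

lemma linear_subspaceD:
  assumes "linear_subspace V"
  shows "(\<lambda>_. 0) \<in> V"
    and "x \<in> V \<Longrightarrow> y \<in> V \<Longrightarrow> (\<lambda>g. x g + c * y g) \<in> V"
  using assms by (auto simp: linear_subspace_def)

lemma linear_subspace_diff:
  assumes "linear_subspace V" "x \<in> V" "y \<in> V"
  shows "(\<lambda>g. x g - y g) \<in> V"
  using linear_subspaceD(2)[OF assms, of "-1"] by simp

lemma linear_subspace_sum:
  assumes V: "linear_subspace V" and "finite I" and "\<And>i. i \<in> I \<Longrightarrow> f i \<in> V"
  shows "(\<lambda>g. \<Sum>i\<in>I. c i * f i g) \<in> V"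
  using assms(2,3)
proof (induction I rule: finite_induct)
  case empty
  then show ?case using linear_subspaceD(1)[OF V] by simp
next
  case (insert i I)
  then have "(\<lambda>g. (\<Sum>i\<in>I. c i * f i g) + c i * f i g) \<in> V"
    by (intro linear_subspaceD(2)[OF V]) auto
  with insert.hyps show ?case by (simp add: add.commute)
qed

text \<open>
  Elimination of one coordinate at a time: if some \<open>v \<in> V\<close> does not vanish at \<open>i\<close>, then
  \<open>V\<close> is the orthogonal sum of \<open>V0 = {x \<in> V. x i = 0}\<close> and the line through
  \<open>u\<close>, which is \<open>v\<close> minus its projection to \<open>V0\<close>.  This is the one result of linear
  algebra behind the theorem: it yields the idempotent that generates an induced ideal, and
  it puts the uniform distribution into every subspace invariant under the walk.
\<close>
lemma orthogonal_projection_exists: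
  fixes V :: "('a \<Rightarrow> complex) set"
  assumes "finite I" and "linear_subspace V" and "\<forall>x\<in>V. \<forall>g. g \<notin> I \<longrightarrow> x g = 0"
  shows "\<exists>p\<in>V. \<forall>y\<in>V. (\<Sum>g\<in>I. (f g - p g) * cnj (y g)) = 0"
  using assms
proof (induction I arbitrary: V f rule: finite_induct)
  case empty
  then show ?case using linear_subspaceD(1) by auto
next
  case (insert i I)
  define V0 where "V0 = {x \<in> V. x i = 0}"
  have V: "linear_subspace V" by fact
  have V0: "linear_subspace V0" "\<forall>x\<in>V0. \<forall>g. g \<notin> I \<longrightarrow> x g = 0"
    using V insert.prems(2) by (auto simp: V0_def linear_subspace_def)
  have ins: "(\<Sum>g\<in>insert i I. F g * cnj (y g)) = (\<Sum>g\<in>I. F g * cnj (y g))" if "y \<in> V0" for F y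
    using insert.hyps that by (simp add: V0_def)
  obtain q where q: "q \<in> V0" "\<forall>y\<in>V0. (\<Sum>g\<in>insert i I. (f g - q g) * cnj (y g)) = 0"
    using insert.IH[OF V0, of f] ins by fastforce
  show ?case
  proof (cases "V0 = V")
    case True
    then show ?thesis using q by auto
  next
    case False
    then obtain v where v: "v \<in> V" "v i \<noteq> 0" by (auto simp: V0_def)
    obtain r where r: "r \<in> V0" "\<forall>y\<in>V0. (\<Sum>g\<in>insert i I. (v g - r g) * cnj (y g)) = 0"
      using insert.IH[OF V0, of v] ins by fastforce
    define u where "u = (\<lambda>g. v g - r g)"
    have u: "u \<in> V" "u i \<noteq> 0"
      using linear_subspace_diff[OF V v(1)] r(1) v(2) by (auto simp: V0_def u_def)
    have ur: "(\<Sum>g\<in>insert i I. u g * cnj (y g)) = 0" if "y \<in> V0" for y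
      using r that by (simp add: u_def)
    have ru: "(\<Sum>g\<in>insert i I. y g * cnj (u g)) = 0" if "y \<in> V0" for y
    proof -
      have "(\<Sum>g\<in>insert i I. y g * cnj (u g)) = cnj (\<Sum>g\<in>insert i I. u g * cnj (y g))"
        by (simp add: mult.commute del: sum.insert)
      then show ?thesis using ur[OF that] by (simp del: sum.insert)
    qed
    define n where "n = (\<Sum>g\<in>insert i I. u g * cnj (u g))"
    have "n = of_real (\<Sum>g\<in>insert i I. (cmod (u g))\<^sup>2)"
      by (simp only: n_def complex_norm_square of_real_sum)
    moreover have "(\<Sum>g\<in>insert i I. (cmod (u g))\<^sup>2) > 0"
      using insert.hyps u by (intro sum_pos2[where i = i]) auto
    ultimately have n: "n \<noteq> 0" by (metis less_irrefl of_real_eq_0_iff)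
    \<comment> \<open>The projections to the orthogonal spaces \<open>V0\<close> and \<open>\<complex>u\<close> add up.\<close>
    define c where "c = (\<Sum>g\<in>insert i I. f g * cnj (u g)) / n"
    define p where "p = (\<lambda>g. q g + c * u g)"
    have "p \<in> V"
      unfolding p_def using q(1) u(1) by (intro linear_subspaceD(2)[OF V]) (auto simp: V0_def)
    moreover have "(\<Sum>g\<in>insert i I. (f g - p g) * cnj (y g)) = 0" if "y \<in> V" for y
    proof -
      define d where "d = y i / u i"
      define y0 where "y0 = (\<lambda>g. y g + (- d) * u g)"
      have y0: "y0 \<in> V0"
        using linear_subspaceD(2)[OF V \<open>y \<in> V\<close> u(1), of "-d"] u(2)
        by (auto simp: V0_def y0_def d_def)
      have y: "cnj (y g) = cnj (y0 g) + cnj d * cnj (u g)" for g by (simp add: y0_def)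
      have "(\<Sum>g\<in>insert i I. (f g - p g) * cnj (y0 g)) =
          (\<Sum>g\<in>insert i I. (f g - q g) * cnj (y0 g)) - c * (\<Sum>g\<in>insert i I. u g * cnj (y0 g))"
        by (simp add: p_def algebra_simps sum_subtractf sum.distrib sum_distrib_left del: sum.insert)
      then have 1: "(\<Sum>g\<in>insert i I. (f g - p g) * cnj (y0 g)) = 0"
        using q(2) y0 ur[OF y0] by (simp del: sum.insert)
      have "(\<Sum>g\<in>insert i I. (f g - p g) * cnj (u g)) =
          (\<Sum>g\<in>insert i I. f g * cnj (u g)) - (\<Sum>g\<in>insert i I. q g * cnj (u g)) - c * n"
        by (simp add: p_def n_def algebra_simps sum_subtractf sum.distrib sum_distrib_left del: sum.insert)
      then have 2: "(\<Sum>g\<in>insert i I. (f g - p g) * cnj (u g)) = 0"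
        using ru[OF q(1)] n by (simp add: c_def del: sum.insert)
      have "(\<Sum>g\<in>insert i I. (f g - p g) * cnj (y g)) =
          (\<Sum>g\<in>insert i I. (f g - p g) * cnj (y0 g)) + cnj d * (\<Sum>g\<in>insert i I. (f g - p g) * cnj (u g))"
        unfolding y by (simp add: algebra_simps sum.distrib sum_subtractf sum_distrib_left del: sum.insert)
      then show ?thesis using 1 2 by simp
    qed
    ultimately show ?thesis by blast
  qed
qed

section \<open>Markov chains with a coarse past\<close>

lemma measurable_event:
  assumes "X \<in> measurable M (count_space S)" and "C \<subseteq> S"
  shows "{\<omega> \<in> space M. X \<omega> \<in> C} \<in> sets M"
proof -
  have "X -` C \<inter> space M \<in> sets M"
    by (rule measurable_sets[OF assms(1)]) (use assms(2) in simp)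
  also have "X -` C \<inter> space M = {\<omega> \<in> space M. X \<omega> \<in> C}" by auto
  finally show ?thesis .
qed

lemma prob_split:
  assumes M: "prob_space M" and X: "X \<in> measurable M (count_space S)"
    and C: "finite C" "C \<subseteq> S" and R: "{\<omega> \<in> space M. R \<omega>} \<in> sets M"
  shows "\<P>(\<omega> in M. X \<omega> \<in> C \<and> R \<omega>) = (\<Sum>x\<in>C. \<P>(\<omega> in M. X \<omega> = x \<and> R \<omega>))"
proof -
  interpret prob_space M by fact
  define B where "B = (\<lambda>x. {\<omega> \<in> space M. X \<omega> = x \<and> R \<omega>})"
  have B: "B x \<in> sets M" if "x \<in> C" for x
  proof -
    have "{\<omega> \<in> space M. X \<omega> \<in> {x}} \<inter> {\<omega> \<in> space M. R \<omega>} \<in> sets M"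
      using that C by (intro sets.Int measurable_event[OF X] R) auto
    also have "{\<omega> \<in> space M. X \<omega> \<in> {x}} \<inter> {\<omega> \<in> space M. R \<omega>} = B x" by (auto simp: B_def)
    finally show ?thesis .
  qed
  have "{\<omega> \<in> space M. X \<omega> \<in> C \<and> R \<omega>} = (\<Union>x\<in>C. B x)" by (auto simp: B_def)
  moreover have "prob (\<Union>x\<in>C. B x) = (\<Sum>x\<in>C. prob (B x))"
    using C(1) B by (intro finite_measure_finite_Union) (auto simp: B_def disjoint_family_on_def)
  ultimately show ?thesis by (simp add: B_def)
qed

text \<open>
  The Markov property is stated for a past given by single states.  It passes to a past given
  by sets of states because the conditional probability depends on the last state only, and
  that is pinned to \<open>h\<close>: the sets are split into their points, one time after the other.
\<close>
lemma markov_chain_coarse_past: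
  fixes B :: "nat \<Rightarrow> 's set"
  assumes mc: "markov_chain M S P X" and S: "finite S"
    and B: "\<And>i. i \<le> t \<Longrightarrow> B i \<subseteq> S" "B t = {h}" and g: "g \<in> S"
  shows "\<P>(\<omega> in M. X (Suc t) \<omega> = g \<and> (\<forall>i\<le>t. X i \<omega> \<in> B i)) =
     P h g * \<P>(\<omega> in M. \<forall>i\<le>t. X i \<omega> \<in> B i)"
proof -
  interpret prob_space M using mc by (simp add: markov_chain_def)
  have X: "\<And>t. X t \<in> measurable M (count_space S)"
    using mc by (simp add: markov_chain_def)
  \<comment> \<open>Induction on the number \<open>s\<close> of initial times at which the past may be coarse.\<close>
  have "\<P>(\<omega> in M. X (Suc t) \<omega> = g \<and> (\<forall>i\<le>t. X i \<omega> \<in> B i)) =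
     P h g * \<P>(\<omega> in M. \<forall>i\<le>t. X i \<omega> \<in> B i)"
    if "s \<le> t" "\<forall>i\<le>t. B i \<subseteq> S" "\<forall>i\<le>t. s \<le> i \<longrightarrow> is_singleton (B i)" "B t = {h}" for s B
    using that
  proof (induction s arbitrary: B)
    case 0
    define xs where "xs = (\<lambda>i. the_elem (B i))"
    have xs: "B i = {xs i}" if "i \<le> t" for i
      using 0(3) that by (simp add: xs_def is_singleton_the_elem)
    have xsS: "\<forall>i\<le>t. xs i \<in> S" using xs 0(2) by blast
    have xst: "xs t = h" using 0(4) by (simp add: xs_def)
    have iff: "(\<forall>i\<le>t. X i \<omega> \<in> B i) \<longleftrightarrow> (\<forall>i\<le>t. X i \<omega> = xs i)" for \<omega>
      by (auto simp: xs)
    have "\<P>(\<omega> in M. X (Suc t) \<omega> = g \<and> (\<forall>i\<le>t. X i \<omega> = xs i)) =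
       P h g * \<P>(\<omega> in M. \<forall>i\<le>t. X i \<omega> = xs i)"
    proof (cases "\<P>(\<omega> in M. \<forall>i\<le>t. X i \<omega> = xs i) = 0")
      case True
      have "\<P>(\<omega> in M. X (Suc t) \<omega> = g \<and> (\<forall>i\<le>t. X i \<omega> = xs i)) \<le>
          \<P>(\<omega> in M. \<forall>i\<le>t. X i \<omega> = xs i)"
        using xsS by (intro finite_measure_mono path_event_sets[OF X]) auto
      then show ?thesis using True by (simp add: measure_le_0_iff)
    next
      case False
      then have "\<P>(\<omega> in M. X (Suc t) \<omega> = g \<bar> \<forall>i\<le>t. X i \<omega> = xs i) = P (xs t) g"
        using mc xsS g unfolding markov_chain_def by blast
      then show ?thesis using False unfolding cond_prob_def xst by (simp add: field_simps)
    qed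
    then show ?case unfolding iff .
  next
    case (Suc s)
    let ?R = "\<lambda>\<omega>. \<forall>i\<in>{..t} - {s}. X i \<omega> \<in> B i"
    have R: "{\<omega> \<in> space M. ?R \<omega>} \<in> sets M"
      using Suc.prems by (intro sets.sets_Collect_finite_All measurable_event[OF X]) auto
    have "{\<omega> \<in> space M. X (Suc t) \<omega> \<in> {g}} \<inter> {\<omega> \<in> space M. ?R \<omega>} \<in> sets M"
      using g by (intro sets.Int measurable_event[OF X] R) auto
    also have "{\<omega> \<in> space M. X (Suc t) \<omega> \<in> {g}} \<inter> {\<omega> \<in> space M. ?R \<omega>} =
        {\<omega> \<in> space M. X (Suc t) \<omega> = g \<and> ?R \<omega>}" by auto
    finally have gR: "{\<omega> \<in> space M. X (Suc t) \<omega> = g \<and> ?R \<omega>} \<in> sets M" .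
    have Bs: "finite (B s)" "B s \<subseteq> S" using Suc.prems(1,2) finite_subset[OF _ S] by auto
    have all: "(\<forall>i\<le>t. X i \<omega> \<in> B i) \<longleftrightarrow> X s \<omega> \<in> B s \<and> ?R \<omega>" for \<omega>
      using Suc.prems(1) by auto
    have one: "(\<forall>i\<le>t. X i \<omega> \<in> (B(s := {x})) i) \<longleftrightarrow> X s \<omega> = x \<and> ?R \<omega>" for \<omega> x
      using Suc.prems(1) by auto
    have IH: "\<P>(\<omega> in M. X (Suc t) \<omega> = g \<and> X s \<omega> = x \<and> ?R \<omega>) =
       P h g * \<P>(\<omega> in M. X s \<omega> = x \<and> ?R \<omega>)" if x: "x \<in> B s" for x
    proof -
      have "\<P>(\<omega> in M. X (Suc t) \<omega> = g \<and> (\<forall>i\<le>t. X i \<omega> \<in> (B(s := {x})) i)) =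
         P h g * \<P>(\<omega> in M. \<forall>i\<le>t. X i \<omega> \<in> (B(s := {x})) i)"
      proof (rule Suc.IH)
        show "\<forall>i\<le>t. (B(s := {x})) i \<subseteq> S" using Suc.prems(2) x Bs by auto
        show "\<forall>i\<le>t. s \<le> i \<longrightarrow> is_singleton ((B(s := {x})) i)"
          using Suc.prems(3) by (auto simp: is_singleton_def le_eq_less_or_eq Suc_le_eq)
      qed (use Suc.prems in auto)
      then show ?thesis unfolding one .
    qed
    have "\<P>(\<omega> in M. X (Suc t) \<omega> = g \<and> (\<forall>i\<le>t. X i \<omega> \<in> B i)) =
        \<P>(\<omega> in M. X s \<omega> \<in> B s \<and> (X (Suc t) \<omega> = g \<and> ?R \<omega>))"
      unfolding all by (simp only: conj_left_commute)
    also have "\<dots> = (\<Sum>x\<in>B s. \<P>(\<omega> in M. X s \<omega> = x \<and> (X (Suc t) \<omega> = g \<and> ?R \<omega>)))"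
      by (rule prob_split[OF prob_space_axioms X Bs gR])
    also have "\<dots> = (\<Sum>x\<in>B s. P h g * \<P>(\<omega> in M. X s \<omega> = x \<and> ?R \<omega>))"
      by (intro sum.cong refl) (simp only: IH[symmetric] conj_left_commute)
    also have "\<dots> = P h g * \<P>(\<omega> in M. X s \<omega> \<in> B s \<and> ?R \<omega>)"
      unfolding prob_split[OF prob_space_axioms X Bs R] by (rule sum_distrib_left[symmetric])
    finally show ?case unfolding all .
  qed
  from this[of t B] show ?thesis using B by (auto simp: is_singleton_def)
qed

section \<open>Convolution and left ideals\<close>

locale finite_group_subgroup = group G + H: subgroup H G
  for G :: "('a, 'b) monoid_scheme" (structure) and H +
  assumes finite_carrier: "finite (carrier G)"
begin

abbreviation A :: "('a \<Rightarrow> complex) ring" where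
  "A \<equiv> group_algebra G"

abbreviation conv (infixl "\<diamondop>" 70) where
  "x \<diamondop> y \<equiv> x \<otimes>\<^bsub>group_algebra G\<^esub> y"

sublocale A: ring "group_algebra G"
  using ring_group_algebra finite_carrier is_group by blast

lemma mult_cancel [simp]:
  assumes "a \<in> carrier G" "b \<in> carrier G"
  shows "a \<otimes> (inv a \<otimes> b) = b" "inv a \<otimes> (a \<otimes> b) = b"
    "b \<otimes> a \<otimes> inv a = b" "b \<otimes> inv a \<otimes> a = b"
  using assms by (simp_all add: m_assoc[symmetric]) (simp_all add: m_assoc)

lemma mem_A_iff: "x \<in> carrier A \<longleftrightarrow> (\<forall>g. g \<notin> carrier G \<longrightarrow> x g = 0)"
  by (simp add: group_algebra_def)

lemma zero_A: "\<zero>\<^bsub>A\<^esub> = (\<lambda>_. 0)"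
  by (simp add: group_algebra_def)

lemma one_A: "\<one>\<^bsub>A\<^esub> = (\<lambda>g. if g = \<one> then 1 else 0)"
  by (simp add: group_algebra_def)

lemma minus_A: "x \<in> carrier A \<Longrightarrow> y \<in> carrier A \<Longrightarrow> x \<ominus>\<^bsub>A\<^esub> y = (\<lambda>g. x g - y g)"
  using group_algebra_minus finite_carrier is_group by blast

lemma conv_apply:
  "(x \<diamondop> y) g = (if g \<in> carrier G then \<Sum>h\<in>carrier G. x h * y (inv h \<otimes> g) else 0)"
  by (simp add: group_algebra_def)

lemma conv_mem_A [simp]: "x \<diamondop> y \<in> carrier A"
  by (simp add: mem_A_iff conv_apply)

lemma conv_apply_right:
  assumes g: "g \<in> carrier G"
  shows "(x \<diamondop> y) g = (\<Sum>s\<in>carrier G. x (g \<otimes> inv s) * y s)"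
proof -
  have "(\<Sum>h\<in>carrier G. x h * y (inv h \<otimes> g)) = (\<Sum>s\<in>carrier G. x (g \<otimes> inv s) * y s)"
    by (rule sum.reindex_bij_witness[where i = "\<lambda>s. g \<otimes> inv s" and j = "\<lambda>h. inv h \<otimes> g"])
      (use g in \<open>auto simp: m_assoc inv_mult_group\<close>)
  with g show ?thesis by (simp add: conv_apply)
qed

lemma conv_linear_left: "(\<lambda>g. x g + c * y g) \<diamondop> z = (\<lambda>g. (x \<diamondop> z) g + c * (y \<diamondop> z) g)"
  by (auto simp: conv_apply fun_eq_iff algebra_simps sum.distrib sum_distrib_left)

lemma conv_zero_left [simp]: "(\<lambda>_. 0) \<diamondop> z = (\<lambda>_. 0)"
  by (simp add: conv_apply fun_eq_iff)

lemma conv_scale_left: "(\<lambda>g. c * y g) \<diamondop> z = (\<lambda>g. c * (y \<diamondop> z) g)"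
  using conv_linear_left[of "\<lambda>_. 0" c y z] by simp

lemma conv_sum_left: "(\<lambda>g. \<Sum>i\<in>I. f i g) \<diamondop> z = (\<lambda>g. \<Sum>i\<in>I. (f i \<diamondop> z) g)"
  unfolding conv_apply fun_eq_iff by (auto simp: sum_distrib_right intro: sum.swap)

text \<open>
  The augmentation \<open>\<complex>[G] \<rightarrow> \<complex>\<close>; on a distribution it is the total probability.
\<close>
definition mass :: "('a \<Rightarrow> complex) \<Rightarrow> complex" where
  "mass x = (\<Sum>g\<in>carrier G. x g)"

lemma mass_linear: "mass (\<lambda>g. x g + c * y g) = mass x + c * mass y"
  by (simp add: mass_def sum.distrib sum_distrib_left)

lemma mass_zero [simp]: "mass (\<lambda>_. 0) = 0"
  by (simp add: mass_def)

lemma mass_scale: "mass (\<lambda>g. c * y g) = c * mass y"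
  by (simp add: mass_def sum_distrib_left)

lemma mass_sum: "mass (\<lambda>g. \<Sum>i\<in>I. f i g) = (\<Sum>i\<in>I. mass (f i))"
  unfolding mass_def by (rule sum.swap)

lemma mass_conv: "mass (x \<diamondop> y) = mass x * mass y"
proof -
  have shift: "(\<Sum>g\<in>carrier G. y (inv h \<otimes> g)) = mass y" if "h \<in> carrier G" for h
    unfolding mass_def
    by (rule sum.reindex_bij_witness[where i = "\<lambda>g. h \<otimes> g" and j = "\<lambda>g. inv h \<otimes> g"])
      (use that in \<open>auto\<close>)
  have "mass (x \<diamondop> y) = (\<Sum>h\<in>carrier G. x h * (\<Sum>g\<in>carrier G. y (inv h \<otimes> g)))"
    unfolding mass_def conv_apply by (simp add: sum_distrib_left) (rule sum.swap)
  also have "\<dots> = mass x * mass y" by (simp add: shift) (simp add: mass_def sum_distrib_right)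
  finally show ?thesis .
qed

lemma weight_elt_mem_A [simp]: "weight_elt G w \<in> carrier A"
  by (simp add: weight_elt_def mem_A_iff)

lemma mass_weight_elt: "mass (weight_elt G w) = complex_of_real (\<Sum>g\<in>carrier G. w g)"
  by (simp add: mass_def weight_elt_def)

lemma mass_weight_pos:
  assumes "weight G w"
  shows "(\<Sum>g\<in>carrier G. w g) > 0"
proof -
  from assms obtain g where "g \<in> carrier G" "w g > 0"
    by (auto simp: weight_def less_eq_real_def)
  then show ?thesis
    using assms finite_carrier by (intro sum_pos2[where i = g]) (auto simp: weight_def)
qed

definition delta :: "'a \<Rightarrow> 'a \<Rightarrow> complex" where
  "delta a = (\<lambda>g. if g = a then 1 else 0)"

lemma delta_mem_A: "a \<in> carrier G \<Longrightarrow> delta a \<in> carrier A"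
  by (auto simp: delta_def mem_A_iff)

lemma delta_conv_apply:
  assumes "a \<in> carrier G"
  shows "(delta a \<diamondop> x) g = (if g \<in> carrier G then x (inv a \<otimes> g) else 0)"
proof -
  have "(\<Sum>h\<in>carrier G. delta a h * x (inv h \<otimes> g)) = (\<Sum>h\<in>carrier G. if h = a then x (inv a \<otimes> g) else 0)"
    by (intro sum.cong) (auto simp: delta_def)
  then show ?thesis using assms finite_carrier by (simp add: conv_apply)
qed

lemma conv_as_sum_of_translates:
  "x \<diamondop> y = (\<lambda>g. \<Sum>a\<in>carrier G. x a * (delta a \<diamondop> y) g)"
proof
  show "(x \<diamondop> y) g = (\<Sum>a\<in>carrier G. x a * (delta a \<diamondop> y) g)" for g
    unfolding conv_apply[of x y] by (simp add: delta_conv_apply)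
qed

text \<open>
  Every element of \<open>\<complex>[G]\<close> is a sum of scalar multiples of group elements, so a left ideal is a
  linear subspace closed under left translation.  All later closure arguments use this form.
\<close>
lemma left_ideal_iff:
  "left_ideal L A \<longleftrightarrow> L \<subseteq> carrier A \<and> linear_subspace L \<and>
     (\<forall>a\<in>carrier G. \<forall>x\<in>L. delta a \<diamondop> x \<in> L)"
proof
  assume L: "left_ideal L A"
  then have add: "additive_subgroup L A" and mult: "\<And>a x. a \<in> carrier A \<Longrightarrow> x \<in> L \<Longrightarrow> a \<diamondop> x \<in> L"
    by (auto simp: left_ideal_def)
  interpret L: additive_subgroup L A by (rule add)
  have "(\<lambda>g. x g + c * y g) \<in> L" if x: "x \<in> L" and y: "y \<in> L" for x y c
  proof -
    have "(\<lambda>g. c * y g) = (\<lambda>g. c * delta \<one> g) \<diamondop> y"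
      using L.a_Hcarr[OF y] by (auto simp: conv_scale_left delta_conv_apply mem_A_iff fun_eq_iff)
    also have "\<dots> \<in> L"
      using y delta_mem_A[of \<one>] by (intro mult) (auto simp: mem_A_iff)
    finally have "x \<oplus>\<^bsub>A\<^esub> (\<lambda>g. c * y g) \<in> L" by (rule L.a_closed[OF x])
    then show ?thesis by (simp add: group_algebra_def)
  qed
  then show "L \<subseteq> carrier A \<and> linear_subspace L \<and> (\<forall>a\<in>carrier G. \<forall>x\<in>L. delta a \<diamondop> x \<in> L)"
    using L.zero_closed L.a_subset mult delta_mem_A by (auto simp: linear_subspace_def zero_A)
next
  assume L: "L \<subseteq> carrier A \<and> linear_subspace L \<and> (\<forall>a\<in>carrier G. \<forall>x\<in>L. delta a \<diamondop> x \<in> L)"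
  then have lin: "linear_subspace L" by simp
  have "a \<diamondop> x \<in> L" if "x \<in> L" for a x
    by (subst conv_as_sum_of_translates, rule linear_subspace_sum[OF lin])
      (use L that finite_carrier in auto)
  moreover have "x \<oplus>\<^bsub>A\<^esub> y \<in> L" if "x \<in> L" "y \<in> L" for x y
    using linear_subspaceD(2)[OF lin that, of 1] by (simp add: group_algebra_def)
  moreover have "\<ominus>\<^bsub>A\<^esub> x \<in> L" if "x \<in> L" for x
  proof -
    have "(\<lambda>_. 0) \<ominus>\<^bsub>A\<^esub> x = (\<lambda>g. 0 - x g)"
      using L that by (intro minus_A) (auto simp: mem_A_iff)
    moreover have "\<ominus>\<^bsub>A\<^esub> x = \<zero>\<^bsub>A\<^esub> \<ominus>\<^bsub>A\<^esub> x" using L that by (auto simp: a_minus_def)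
    ultimately show ?thesis
      using linear_subspace_diff[OF lin linear_subspaceD(1)[OF lin] that] by (simp add: zero_A)
  qed
  moreover have "additive_subgroup L A"
    unfolding additive_subgroup_def
  proof (rule A.add.subgroupI)
    show "L \<subseteq> carrier A" using L by simp
    show "L \<noteq> {}" using linear_subspaceD(1)[OF lin] by blast
  qed (use calculation in \<open>simp_all add: a_inv_def\<close>)
  ultimately show "left_ideal L A"
    by (simp add: left_ideal_def)
qed

section \<open>Left cosets and averaging over them\<close>

abbreviation cosets :: "'a set set" where
  "cosets \<equiv> lcosets H"

lemma H_subgroup: "subgroup H G"
  by (rule H.subgroup_axioms)

lemma coset_subset: "C \<in> cosets \<Longrightarrow> C \<subseteq> carrier G"
  by (rule H.lcosets_carrier[OF is_group])

lemma finite_coset: "C \<in> cosets \<Longrightarrow> finite C"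
  using coset_subset finite_carrier finite_subset by blast

lemma finite_cosets: "finite cosets"
  using finite_carrier by (rule lcosets_finite)

lemma card_coset: "C \<in> cosets \<Longrightarrow> card C = card H"
  using l_card_cosets_equal H.subset finite_carrier by metis

lemma card_H_pos: "card H > 0"
  using H.subset finite_carrier H.one_closed by (metis card_gt_0_iff empty_iff finite_subset)

lemma card_G_pos: "card (carrier G) > 0"
  using finite_carrier by (metis card_gt_0_iff empty_iff one_closed)

lemma H_coset: "H \<in> cosets"
  using lcosets_memI[of \<one> G H] lcos_mult_one[OF H.subset] by simp

lemma lcoset_eq_iff:
  assumes "g \<in> carrier G" and "C \<in> cosets"
  shows "g <# H = C \<longleftrightarrow> g \<in> C"
proof
  assume "g <# H = C"
  then show "g \<in> C" using lcos_self[OF assms(1) H_subgroup] by simp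
next
  assume "g \<in> C"
  then have "(g <# H) \<inter> C \<noteq> {}" using lcos_self[OF assms(1) H_subgroup] by blast
  then show "g <# H = C"
    using lcos_disjoint[OF H_subgroup lcosets_memI[OF assms(1)] assms(2)] by blast
qed

lemma mem_lcoset_iff:
  assumes "g \<in> carrier G" "h \<in> carrier G"
  shows "h \<in> g <# H \<longleftrightarrow> inv h \<otimes> g \<in> H"
proof -
  have "h \<in> g <# H \<longleftrightarrow> g \<in> h <# H"
    using assms lcoset_eq_iff[of h "g <# H"] lcoset_eq_iff[of g "h <# H"] lcosets_memI by metis
  also have "\<dots> \<longleftrightarrow> inv h \<otimes> g \<in> H"
    using H.lcos_module_rev[OF is_group] H.lcos_module_imp[OF is_group] assms by blast
  finally show ?thesis .
qed

lemma translate_coset: "a \<in> carrier G \<Longrightarrow> C \<in> cosets \<Longrightarrow> a <# C \<in> cosets"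
  using lcos_m_assoc[OF H.subset] by (auto simp: LCOSETS_def)

lemma proj_linear: "proj C (\<lambda>g. x g + c * y g) = (\<lambda>g. proj C x g + c * proj C y g)"
  by (auto simp: proj_def)

lemma proj_zero [simp]: "proj C (\<lambda>_. 0) = (\<lambda>_. 0)"
  by (auto simp: proj_def)

lemma proj_sum: "proj C (\<lambda>g. \<Sum>i\<in>I. f i g) = (\<lambda>g. \<Sum>i\<in>I. proj C (f i) g)"
  by (auto simp: proj_def)

lemma proj_mem_A: "x \<in> carrier A \<Longrightarrow> proj C x \<in> carrier A"
  by (auto simp: proj_def mem_A_iff)

lemma proj_proj:
  assumes "C \<in> cosets" "D \<in> cosets"
  shows "proj C (proj D x) = (if C = D then proj C x else (\<lambda>_. 0))"
  using lcos_disjoint[OF H_subgroup assms] by (auto simp: proj_def fun_eq_iff)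

text \<open>
  Left translation permutes the left cosets, so restricting to a coset commutes with it up to
  this permutation.  That is what makes the lumpable elements below a left ideal.
\<close>
lemma proj_translate:
  assumes a: "a \<in> carrier G" and C: "C \<in> cosets"
  shows "proj C (delta a \<diamondop> x) = delta a \<diamondop> proj (inv a <# C) x"
proof
  fix g
  have "inv a \<otimes> g \<in> inv a <# C \<longleftrightarrow> g \<in> C" if g: "g \<in> carrier G"
  proof
    assume "inv a \<otimes> g \<in> inv a <# C"
    then obtain c where "c \<in> C" "inv a \<otimes> g = inv a \<otimes> c" by (auto simp: l_coset_def)
    then show "g \<in> C" using a g coset_subset[OF C] by (metis mult_cancel(1) subsetD)
  qed (auto simp: l_coset_def)
  then show "proj C (delta a \<diamondop> x) g = (delta a \<diamondop> proj (inv a <# C) x) g"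
    using a coset_subset[OF C] by (auto simp: proj_def delta_conv_apply)
qed

lemma sum_over_cosets:
  assumes g: "g \<in> carrier G"
  shows "(\<Sum>C\<in>cosets. proj C x g) = x g"
proof -
  have "(\<Sum>C\<in>cosets. proj C x g) = (\<Sum>C\<in>cosets. if C = g <# H then x g else 0)"
    using lcoset_eq_iff[OF g] by (intro sum.cong) (auto simp: proj_def)
  then show ?thesis using lcosets_memI[OF g] finite_cosets by simp
qed

lemma sum_proj_cosets:
  assumes x: "x \<in> carrier A"
  shows "(\<lambda>g. \<Sum>C\<in>cosets. proj C x g) = x"
proof
  show "(\<Sum>C\<in>cosets. proj C x g) = x g" for g
  proof (cases "g \<in> carrier G")
    case True
    then show ?thesis by (rule sum_over_cosets)
  next
    case False
    then have "x g = 0" using x by (simp add: mem_A_iff)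
    then show ?thesis by (simp add: proj_def cong: if_cong)
  qed
qed

lemma mass_proj:
  assumes "C \<in> cosets"
  shows "mass (proj C x) = (\<Sum>g\<in>C. x g)"
  unfolding mass_def proj_def
  using coset_subset[OF assms] finite_carrier by (simp add: sum.If_cases inf.absorb2)

lemma eta_mem_A: "C \<subseteq> carrier G \<Longrightarrow> eta C \<in> carrier A"
  by (auto simp: eta_def mem_A_iff)

lemma eta_H_mem_A [simp]: "eta H \<in> carrier A"
  using eta_mem_A H.subset by blast

lemma mass_eta: "C \<subseteq> carrier G \<Longrightarrow> C \<noteq> {} \<Longrightarrow> mass (eta C) = 1"
  unfolding mass_def eta_def
  using finite_carrier finite_subset[of C "carrier G"]
  by (simp add: sum.If_cases inf.absorb2 card_gt_0_iff)

lemma mass_eta_coset: "C \<in> cosets \<Longrightarrow> mass (eta C) = 1"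
  using mass_eta coset_subset card_coset card_H_pos by (metis card.empty less_irrefl)

lemma proj_eta_carrier:
  assumes C: "C \<in> cosets"
  shows "proj C (eta (carrier G)) = (\<lambda>g. of_nat (card H) / of_nat (card (carrier G)) * eta C g)"
  using coset_subset[OF C] card_coset[OF C] card_H_pos by (auto simp: proj_def eta_def fun_eq_iff)

lemma mass_eta_H [simp]: "mass (eta H) = 1"
  using mass_eta[OF H.subset] H.one_closed by blast

text \<open>
  Right multiplication by \<open>\<eta>\<^sub>H\<close> keeps of \<open>x\<close> only the masses of the left cosets: it is the
  algebraic form of observing \<open>X\<^sub>t H\<close> instead of \<open>X\<^sub>t\<close>.
\<close>
lemma conv_eta_H:
  assumes g: "g \<in> carrier G"
  shows "(x \<diamondop> eta H) g = mass (proj (g <# H) x) / of_nat (card H)"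
proof -
  have "(\<Sum>h\<in>carrier G. x h * eta H (inv h \<otimes> g)) = (\<Sum>h\<in>carrier G. proj (g <# H) x h / of_nat (card H))"
    by (intro sum.cong refl) (use g in \<open>simp add: eta_def proj_def mem_lcoset_iff\<close>)
  then show ?thesis using g by (simp add: conv_apply mass_def sum_divide_distrib)
qed

lemma conv_eta_H_supported:
  assumes C: "C \<in> cosets"
  shows "proj C x \<diamondop> eta H = (\<lambda>g. mass (proj C x) * eta C g)"
proof
  fix g
  show "(proj C x \<diamondop> eta H) g = mass (proj C x) * eta C g"
  proof (cases "g \<in> carrier G")
    case True
    have "(proj C x \<diamondop> eta H) g = mass (proj (g <# H) (proj C x)) / of_nat (card H)"
      by (rule conv_eta_H[OF True])
    also have "\<dots> = (if g \<in> C then mass (proj C x) / of_nat (card C) else 0)"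
      using C lcoset_eq_iff[OF True C] lcosets_memI[OF True]
      by (auto simp: proj_proj card_coset)
    finally show ?thesis by (simp add: eta_def)
  next
    case False
    then show ?thesis using coset_subset[OF C] by (auto simp: conv_apply eta_def)
  qed
qed

section \<open>Defects along coset paths\<close>

text \<open>
  The difference between the coset distribution after one step from \<open>x\<close> and the one after one
  step from the average of \<open>x\<close> over cosets.
\<close>
definition defect :: "('a \<Rightarrow> complex) \<Rightarrow> ('a \<Rightarrow> complex) \<Rightarrow> 'a \<Rightarrow> complex" where
  "defect v x = x \<diamondop> (\<one>\<^bsub>A\<^esub> \<ominus>\<^bsub>A\<^esub> eta H) \<diamondop> v \<diamondop> eta H"

lemma defect_linear: "defect v (\<lambda>g. x g + c * y g) = (\<lambda>g. defect v x g + c * defect v y g)"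
  by (simp only: defect_def conv_linear_left)

lemma defect_zero [simp]: "defect v (\<lambda>_. 0) = (\<lambda>_. 0)"
  by (simp add: defect_def)

lemma defect_sum: "defect v (\<lambda>g. \<Sum>i\<in>I. f i g) = (\<lambda>g. \<Sum>i\<in>I. defect v (f i) g)"
  by (simp only: defect_def conv_sum_left)

lemma defect_translate:
  assumes "a \<in> carrier G" "x \<in> carrier A" "v \<in> carrier A"
  shows "defect v (delta a \<diamondop> x) = delta a \<diamondop> defect v x"
  using assms delta_mem_A by (simp add: defect_def A.m_assoc)

lemma defect_eq:
  assumes "x \<in> carrier A" "v \<in> carrier A"
  shows "defect v x = (\<lambda>g. (x \<diamondop> v \<diamondop> eta H) g - (x \<diamondop> eta H \<diamondop> v \<diamondop> eta H) g)"
proof -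
  have "x \<diamondop> (\<one>\<^bsub>A\<^esub> \<ominus>\<^bsub>A\<^esub> eta H) = (\<lambda>g. x g - (x \<diamondop> eta H) g)"
    using assms by (simp add: a_minus_def A.r_distr A.r_minus flip: minus_A)
  then show ?thesis
    using conv_linear_left[of x "-1"] conv_linear_left[of "x \<diamondop> v" "-1"] by (simp add: defect_def)
qed

text \<open>
  Averaging an element supported on \<open>C\<close> over cosets leaves only its mass, times \<open>\<eta>\<^sub>C\<close>.
  The defect thus vanishes exactly if the step to each coset \<open>D\<close> is made with the same
  probability as from the uniform distribution on \<open>C\<close>.
\<close>
lemma defect_proj_eq_zero_iff:
  assumes x: "x \<in> carrier A" and v: "v \<in> carrier A" and C: "C \<in> cosets"
  shows "defect v (proj C x) = (\<lambda>_. 0) \<longleftrightarrow>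
    (\<forall>D\<in>cosets. mass (proj D (proj C x \<diamondop> v)) = mass (proj C x) * mass (proj D (eta C \<diamondop> v)))"
proof -
  let ?m = "mass (proj C x)"
  have scale: "proj D (\<lambda>g. c * y g) = (\<lambda>g. c * proj D y g)" for D c y
    using proj_linear[of D "\<lambda>_. 0" c y] by simp
  have "defect v (proj C x) g =
      (if g \<in> carrier G then (mass (proj (g <# H) (proj C x \<diamondop> v)) -
          ?m * mass (proj (g <# H) (eta C \<diamondop> v))) / of_nat (card H) else 0)" for g
    using conv_mem_A[of "proj C x \<diamondop> v" "eta H"] conv_mem_A[of "eta C \<diamondop> v" "eta H"]
    by (cases "g \<in> carrier G")
      (simp_all add: defect_eq[OF proj_mem_A[OF x] v] conv_eta_H_supported[OF C] conv_scale_left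
         conv_eta_H scale mass_scale diff_divide_distrib mem_A_iff del: conv_mem_A)
  then have "defect v (proj C x) = (\<lambda>_. 0) \<longleftrightarrow>
     (\<forall>g\<in>carrier G. mass (proj (g <# H) (proj C x \<diamondop> v)) = ?m * mass (proj (g <# H) (eta C \<diamondop> v)))"
    using card_H_pos by (auto simp: fun_eq_iff)
  then show ?thesis by (auto simp: LCOSETS_def)
qed

text \<open>
  The unnormalised law of \<open>X\<^sub>t\<close>, with \<open>t\<close> the length of \<open>Cs\<close>, on the event that \<open>X\<^sub>0, \<dots>, X\<^sub>t\<^sub>-\<^sub>1\<close>
  lie in the cosets listed in \<open>Cs\<close>, when \<open>X\<^sub>0\<close> has law \<open>x\<close>.  The coset of \<open>X\<^sub>t\<close> itself is not
  yet fixed; for this one applies a final projection.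
\<close>
definition walk :: "('a \<Rightarrow> complex) \<Rightarrow> ('a \<Rightarrow> complex) \<Rightarrow> 'a set list \<Rightarrow> 'a \<Rightarrow> complex" where
  "walk v x Cs = fold (\<lambda>C y. proj C y \<diamondop> v) Cs x"

lemma walk_simps [simp]:
  "walk v x [] = x"
  "walk v x (C # Cs) = walk v (proj C x \<diamondop> v) Cs"
  "walk v x (Cs @ [C]) = proj C (walk v x Cs) \<diamondop> v"
  by (simp_all add: walk_def)

lemma walk_mem_A: "x \<in> carrier A \<Longrightarrow> walk v x Cs \<in> carrier A"
  by (induction Cs arbitrary: x) simp_all

lemma walk_zero [simp]: "walk v (\<lambda>_. 0) Cs = (\<lambda>_. 0)"
  by (induction Cs) simp_all

lemma walk_linear:
  "walk v (\<lambda>g. x g + c * y g) Cs = (\<lambda>g. walk v x Cs g + c * walk v y Cs g)"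
  by (induction Cs arbitrary: x y) (simp_all add: proj_linear conv_linear_left)

lemma walk_sum: "walk v (\<lambda>g. \<Sum>i\<in>I. f i g) Cs = (\<lambda>g. \<Sum>i\<in>I. walk v (f i) Cs g)"
  by (induction Cs arbitrary: f) (simp_all add: proj_sum conv_sum_left)

lemma walk_translate:
  assumes a: "a \<in> carrier G" and "x \<in> carrier A" and v: "v \<in> carrier A" and "set Cs \<subseteq> cosets"
  shows "walk v (delta a \<diamondop> x) Cs = delta a \<diamondop> walk v x (map (\<lambda>D. inv a <# D) Cs)"
  using assms(2,4)
proof (induction Cs arbitrary: x)
  case (Cons C Cs)
  then show ?case
    using a v delta_mem_A by (simp add: proj_translate A.m_assoc proj_mem_A)
qed simp

text \<open>
  Taking a step unobserved means summing over the coset in which it started.  Hence what holds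
  for all coset paths from \<open>x\<close> also holds for those from \<open>x \<diamondop> v\<close>.
\<close>
lemma walk_step:
  assumes "x \<in> carrier A"
  shows "walk v (x \<diamondop> v) Cs = (\<lambda>g. \<Sum>C\<in>cosets. walk v x (C # Cs) g)"
proof -
  have "x \<diamondop> v = (\<lambda>g. \<Sum>C\<in>cosets. (proj C x \<diamondop> v) g)"
    using conv_sum_left[of "\<lambda>C. proj C x" cosets v] sum_proj_cosets[OF assms] by simp
  then show ?thesis using walk_sum by simp
qed

text \<open>
  The starting elements for which no coset path ever shows a defect.  For \<open>v \<in> \<complex>[G]\<close> this is the
  largest induced left ideal that is closed under right multiplication by \<open>v\<close> and on which the defect
  vanishes.
\<close>
definition lumpable_elements :: "('a \<Rightarrow> complex) \<Rightarrow> ('a \<Rightarrow> complex) set" where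
  "lumpable_elements v =
     {x \<in> carrier A. \<forall>Cs C. set Cs \<subseteq> cosets \<longrightarrow> C \<in> cosets \<longrightarrow>
        defect v (proj C (walk v x Cs)) = (\<lambda>_. 0)}"

lemma lumpable_elementsD:
  "x \<in> lumpable_elements v \<Longrightarrow> set Cs \<subseteq> cosets \<Longrightarrow> C \<in> cosets \<Longrightarrow>
     defect v (proj C (walk v x Cs)) = (\<lambda>_. 0)"
  by (simp add: lumpable_elements_def)

text \<open>
  Translating \<open>x\<close> by \<open>a\<close> has the same effect as translating the coset path by \<open>a\<^sup>-\<^sup>1\<close>, and the
  definition ranges over all coset paths.
\<close>
lemma lumpable_elements_left_ideal:
  assumes v: "v \<in> carrier A"
  shows "left_ideal (lumpable_elements v) A"
  unfolding left_ideal_iff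
proof (intro conjI ballI)
  show "lumpable_elements v \<subseteq> carrier A" by (auto simp: lumpable_elements_def)
  show "linear_subspace (lumpable_elements v)"
    unfolding linear_subspace_def
    by (auto simp: lumpable_elements_def mem_A_iff walk_linear proj_linear defect_linear)
  fix a x assume a: "a \<in> carrier G" and x: "x \<in> lumpable_elements v"
  have xA: "x \<in> carrier A" using x by (simp add: lumpable_elements_def)
  show "delta a \<diamondop> x \<in> lumpable_elements v"
    unfolding lumpable_elements_def
  proof (intro CollectI conjI allI impI)
    show "delta a \<diamondop> x \<in> carrier A" by simp
    fix Cs C assume Cs: "set Cs \<subseteq> cosets" and C: "C \<in> cosets"
    let ?y = "proj (inv a <# C) (walk v x (map (\<lambda>D. inv a <# D) Cs))"
    have "defect v (proj C (walk v (delta a \<diamondop> x) Cs)) = delta a \<diamondop> defect v ?y"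
      using a C Cs xA v
      by (simp add: walk_translate proj_translate defect_translate proj_mem_A walk_mem_A)
    moreover have "defect v ?y = (\<lambda>_. 0)"
      using a C Cs translate_coset[of "inv a"] by (intro lumpable_elementsD[OF x]) auto
    ultimately show "defect v (proj C (walk v (delta a \<diamondop> x) Cs)) = (\<lambda>_. 0)"
      by (simp add: conv_apply fun_eq_iff)
  qed
qed

lemma lumpable_elements_induced:
  assumes v: "v \<in> carrier A"
  shows "induced_left_ideal G H (lumpable_elements v)"
proof -
  have "proj H x \<in> lumpable_elements v" if x: "x \<in> lumpable_elements v" for x
    unfolding lumpable_elements_def
  proof (intro CollectI conjI allI impI)
    show "proj H x \<in> carrier A" using x by (simp add: lumpable_elements_def proj_mem_A)
    fix Cs C assume Cs: "set Cs \<subseteq> cosets" and C: "C \<in> cosets"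
    \<comment> \<open>Restricting \<open>x\<close> to \<open>H\<close> kills the paths that start in another coset and keeps the rest.\<close>
    have "proj C (walk v (proj H x) Cs) \<in> {proj C (walk v x Cs), \<lambda>_. 0}"
      using Cs C H_coset by (cases Cs) (simp_all add: proj_proj)
    then show "defect v (proj C (walk v (proj H x) Cs)) = (\<lambda>_. 0)"
      using lumpable_elementsD[OF x Cs C] by auto
  qed
  then show ?thesis
    using lumpable_elements_left_ideal[OF v] by (auto simp: induced_left_ideal_def)
qed

lemma lumpable_elements_step:
  assumes x: "x \<in> lumpable_elements v"
  shows "x \<diamondop> v \<in> lumpable_elements v"
proof -
  have "x \<in> carrier A" using x by (simp add: lumpable_elements_def)
  then show ?thesis
    using lumpable_elementsD[OF x]
    by (auto simp: lumpable_elements_def walk_step proj_sum defect_sum simp del: walk_simps)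
qed

section \<open>Gurvits--Ledoux ideals and their idempotents\<close>

lemma minimal_GL_ideal_GL: "gurvits_ledoux_ideal G H w (minimal_GL_ideal G H w)"
proof -
  let ?L = "minimal_GL_ideal G H w"
  have all: "x \<in> ?L \<longleftrightarrow> (\<forall>L. gurvits_ledoux_ideal G H w L \<longrightarrow> x \<in> L)" for x
    by (auto simp: minimal_GL_ideal_def)
  have GL: "gurvits_ledoux_ideal G H w L \<longleftrightarrow> L \<subseteq> carrier A \<and> linear_subspace L \<and>
     (\<forall>a\<in>carrier G. \<forall>x\<in>L. delta a \<diamondop> x \<in> L) \<and> proj H ` L \<subseteq> L \<and> eta (carrier G) \<in> L \<and>
     (\<forall>x\<in>L. x \<diamondop> weight_elt G w \<in> L)" for L
    by (auto simp: gurvits_ledoux_ideal_def induced_left_ideal_def left_ideal_iff)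
  \<comment> \<open>\<open>\<complex>[G]\<close> itself is such an ideal, so the intersection does not run over the empty family.\<close>
  have "gurvits_ledoux_ideal G H w (carrier A)"
    unfolding GL using eta_mem_A[of "carrier G"] proj_mem_A
    by (auto simp: linear_subspace_def mem_A_iff conv_apply)
  then have sub: "?L \<subseteq> carrier A" using all by blast
  have lin: "linear_subspace L" if "gurvits_ledoux_ideal G H w L" for L
    using that by (simp add: GL)
  have "linear_subspace ?L"
    unfolding linear_subspace_def
  proof (intro conjI ballI allI)
    show "(\<lambda>_. 0) \<in> ?L" using linear_subspaceD(1)[OF lin] by (simp add: all)
    fix x y c assume "x \<in> ?L" "y \<in> ?L"
    then show "(\<lambda>g. x g + c * y g) \<in> ?L" by (simp add: all linear_subspaceD(2)[OF lin])
  qed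
  moreover have "delta a \<diamondop> x \<in> ?L" if "a \<in> carrier G" "x \<in> ?L" for a x
    using that unfolding all by (simp add: GL)
  moreover have "proj H x \<in> ?L" "x \<diamondop> weight_elt G w \<in> ?L" if "x \<in> ?L" for x
    using that unfolding all by (simp_all add: GL image_subset_iff)
  moreover have "eta (carrier G) \<in> ?L" unfolding all by (simp add: GL)
  ultimately show ?thesis using sub by (simp add: GL image_subset_iff)
qed

lemma induced_left_idealD:
  assumes "induced_left_ideal G H L"
  shows "L \<subseteq> carrier A" and "linear_subspace L"
    and "a \<in> carrier G \<Longrightarrow> x \<in> L \<Longrightarrow> delta a \<diamondop> x \<in> L"
    and "y \<in> carrier A \<Longrightarrow> x \<in> L \<Longrightarrow> y \<diamondop> x \<in> L"
    and "x \<in> L \<Longrightarrow> proj H x \<in> L"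
proof -
  have L: "left_ideal L A" "proj H ` L \<subseteq> L"
    using assms by (simp_all add: induced_left_ideal_def)
  then show "L \<subseteq> carrier A" "linear_subspace L"
    "a \<in> carrier G \<Longrightarrow> x \<in> L \<Longrightarrow> delta a \<diamondop> x \<in> L" "x \<in> L \<Longrightarrow> proj H x \<in> L"
    unfolding left_ideal_iff by blast+
  show "y \<in> carrier A \<Longrightarrow> x \<in> L \<Longrightarrow> y \<diamondop> x \<in> L"
    using L(1) by (simp add: left_ideal_def)
qed

lemma induced_ideal_proj_coset:
  assumes L: "induced_left_ideal G H L" and x: "x \<in> L" and C: "C \<in> cosets"
  shows "proj C x \<in> L"
proof -
  note tr = induced_left_idealD(3)[OF L] and pr = induced_left_idealD(5)[OF L]
  have xA: "x \<in> carrier A" using induced_left_idealD(1)[OF L] x by blast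
  obtain a where a: "a \<in> carrier G" and Ca: "C = a <# H" using C by (auto simp: LCOSETS_def)
  have "inv a <# C = H"
    unfolding Ca using a by (simp add: lcos_m_assoc[OF H.subset] lcos_mult_one[OF H.subset])
  moreover have "delta a \<diamondop> (delta (inv a) \<diamondop> x) = x"
    using a xA by (auto simp: delta_conv_apply fun_eq_iff mem_A_iff)
  ultimately have "proj C x = delta a \<diamondop> proj H (delta (inv a) \<diamondop> x)"
    using proj_translate[OF a C, of "delta (inv a) \<diamondop> x"] by simp
  then show ?thesis using a x tr pr by simp
qed

text \<open>
  If \<open>\<eta>\<^sub>G\<close> is lumpable, then the lumpable elements form a Gurvits--Ledoux ideal, which contains
  the minimal one.  Conversely every element reached from \<open>\<eta>\<^sub>G\<close> along a coset path stays in the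
  minimal ideal.
\<close>
lemma minimal_GL_ideal_defect_iff:
  "(\<forall>x\<in>minimal_GL_ideal G H w. defect (weight_elt G w) x = (\<lambda>_. 0)) \<longleftrightarrow>
     eta (carrier G) \<in> lumpable_elements (weight_elt G w)"
proof
  let ?L = "minimal_GL_ideal G H w" and ?v = "weight_elt G w"
  have L: "induced_left_ideal G H ?L" "eta (carrier G) \<in> ?L" "\<And>x. x \<in> ?L \<Longrightarrow> x \<diamondop> ?v \<in> ?L"
    using minimal_GL_ideal_GL by (auto simp: gurvits_ledoux_ideal_def)
  have walk: "walk ?v x Cs \<in> ?L" if "x \<in> ?L" "set Cs \<subseteq> cosets" for x Cs
    using that by (induction Cs arbitrary: x) (auto intro: L(3) induced_ideal_proj_coset[OF L(1)])
  assume "\<forall>x\<in>?L. defect ?v x = (\<lambda>_. 0)"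
  then show "eta (carrier G) \<in> lumpable_elements ?v"
    using walk[OF L(2)] induced_ideal_proj_coset[OF L(1)] eta_mem_A
    by (auto simp: lumpable_elements_def)
next
  let ?L = "minimal_GL_ideal G H w" and ?v = "weight_elt G w"
  assume "eta (carrier G) \<in> lumpable_elements ?v"
  then have "gurvits_ledoux_ideal G H w (lumpable_elements ?v)"
    by (simp add: gurvits_ledoux_ideal_def lumpable_elements_induced lumpable_elements_step)
  then have sub: "?L \<subseteq> lumpable_elements ?v" by (auto simp: minimal_GL_ideal_def)
  show "\<forall>x\<in>?L. defect ?v x = (\<lambda>_. 0)"
  proof
    fix x assume "x \<in> ?L"
    then have x: "x \<in> lumpable_elements ?v" using sub by blast
    then have "x \<in> carrier A" by (simp add: lumpable_elements_def)
    then have "defect ?v x = (\<lambda>g. \<Sum>C\<in>cosets. defect ?v (proj C x) g)"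
      using defect_sum[of ?v "\<lambda>C. proj C x" cosets] sum_proj_cosets by simp
    then show "defect ?v x = (\<lambda>_. 0)"
      using lumpable_elementsD[OF x, of "[]"] by simp
  qed
qed

text \<open>
  The generator is \<open>\<pi>\<^sub>H p\<close> where \<open>p\<close> is the orthogonal projection of \<open>1\<close> to \<open>L\<close>.  Since \<open>\<pi>\<^sub>H\<close> is
  self-adjoint, fixes \<open>1\<close> and preserves \<open>L\<close>, also \<open>1 - e\<close> is orthogonal to \<open>L\<close>.  As in Maschke's
  theorem, the orthogonal complement of \<open>L\<close> is a left ideal because translations are unitary;
  hence \<open>x(1 - e)\<close> lies both in \<open>L\<close> and in its complement.
\<close>
lemma induced_ideal_idempotent:
  assumes L: "induced_left_ideal G H L"
  obtains e where "e \<in> L" "\<And>g. g \<notin> H \<Longrightarrow> e g = 0" "\<And>x. x \<in> L \<Longrightarrow> x \<diamondop> e = x"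
proof -
  note LA = induced_left_idealD(1)[OF L] and lin = induced_left_idealD(2)[OF L]
    and tr = induced_left_idealD(3)[OF L] and mult = induced_left_idealD(4)[OF L]
    and pr = induced_left_idealD(5)[OF L]
  have supp: "\<forall>x\<in>L. \<forall>g. g \<notin> carrier G \<longrightarrow> x g = 0"
    using LA by (auto simp: mem_A_iff)
  obtain p where p: "p \<in> L"
    "\<forall>y\<in>L. (\<Sum>g\<in>carrier G. (\<one>\<^bsub>A\<^esub> g - p g) * cnj (y g)) = 0"
    using orthogonal_projection_exists[OF finite_carrier lin supp, of "\<one>\<^bsub>A\<^esub>"] by (rule bexE)
  define e where "e = proj H p"
  have e: "e \<in> L" and eA: "e \<in> carrier A" using pr[OF p(1)] LA by (auto simp: e_def)
  have orth: "(\<Sum>g\<in>carrier G. (\<one>\<^bsub>A\<^esub> g - e g) * cnj (y g)) = 0" if y: "y \<in> L" for y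
  proof -
    have "(\<one>\<^bsub>A\<^esub> g - e g) * cnj (y g) = (\<one>\<^bsub>A\<^esub> g - p g) * cnj (proj H y g)" for g
      using H.one_closed by (auto simp: e_def proj_def one_A)
    then show ?thesis using bspec[OF p(2) pr[OF y]] by simp
  qed
  have "x \<diamondop> e = x" if x: "x \<in> L" for x
  proof -
    have xA: "x \<in> carrier A" using x LA by blast
    define z where "z = (\<lambda>g. x g - (x \<diamondop> e) g)"
    have zL: "z \<in> L"
      unfolding z_def by (rule linear_subspace_diff[OF lin x mult[OF xA e]])
    have z: "z = x \<diamondop> (\<lambda>g. \<one>\<^bsub>A\<^esub> g - e g)"
    proof -
      have "x \<diamondop> (\<one>\<^bsub>A\<^esub> \<ominus>\<^bsub>A\<^esub> e) = x \<ominus>\<^bsub>A\<^esub> x \<diamondop> e"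
        using xA eA by (simp add: a_minus_def A.r_distr A.r_minus)
      then show ?thesis using xA eA by (simp add: z_def minus_A)
    qed
    have "(\<Sum>g\<in>carrier G. z g * cnj (z g)) =
        (\<Sum>h\<in>carrier G. x h * (\<Sum>g\<in>carrier G. (\<one>\<^bsub>A\<^esub> (inv h \<otimes> g) - e (inv h \<otimes> g)) * cnj (z g)))"
      by (subst (1) z, simp add: conv_apply sum_distrib_right sum_distrib_left mult.assoc)
        (rule sum.swap)
    also have "\<dots> = 0"
    proof (intro sum.neutral ballI)
      fix h assume h: "h \<in> carrier G"
      have "(\<Sum>g\<in>carrier G. (\<one>\<^bsub>A\<^esub> (inv h \<otimes> g) - e (inv h \<otimes> g)) * cnj (z g)) =
          (\<Sum>g\<in>carrier G. (\<one>\<^bsub>A\<^esub> g - e g) * cnj ((delta (inv h) \<diamondop> z) g))"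
        by (rule sum.reindex_bij_witness[where i = "\<lambda>g. h \<otimes> g" and j = "\<lambda>g. inv h \<otimes> g"])
          (use h in \<open>auto simp: delta_conv_apply\<close>)
      then show "x h * (\<Sum>g\<in>carrier G. (\<one>\<^bsub>A\<^esub> (inv h \<otimes> g) - e (inv h \<otimes> g)) * cnj (z g)) = 0"
        using orth[OF tr[OF inv_closed[OF h] zL]] by simp
    qed
    finally have "of_real (\<Sum>g\<in>carrier G. (cmod (z g))\<^sup>2) = (0::complex)"
      by (simp only: complex_norm_square of_real_sum)
    then have "(\<Sum>g\<in>carrier G. (cmod (z g))\<^sup>2) = 0" by (simp only: of_real_eq_0_iff)
    then have "\<forall>g\<in>carrier G. z g = 0" using finite_carrier by (simp add: sum_nonneg_eq_0_iff)
    then show ?thesis using xA by (auto simp: z_def mem_A_iff conv_apply fun_eq_iff)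
  qed
  moreover have "e g = 0" if "g \<notin> H" for g using that by (simp add: e_def proj_def)
  ultimately show thesis using that e by blast
qed

lemma E_bullet_mem_A: "e \<in> E_bullet G H \<Longrightarrow> e \<in> carrier A"
  using H.subset by (auto simp: E_bullet_def mem_A_iff)

text \<open>
  The condition \<open>\<eta>\<^sub>H e = \<eta>\<^sub>H\<close> gives \<open>e\<close> mass 1; as \<open>e\<close> is supported on \<open>H\<close>, also
  \<open>e \<eta>\<^sub>H = \<eta>\<^sub>H\<close>.
\<close>
lemma defect_E_bullet:
  assumes e: "e \<in> E_bullet G H"
  shows "defect v e = (e \<ominus>\<^bsub>A\<^esub> eta H) \<diamondop> v \<diamondop> eta H"
proof -
  have eA: "e \<in> carrier A" using e by (rule E_bullet_mem_A)
  have eproj: "proj H e = e" using e by (auto simp: E_bullet_def proj_def fun_eq_iff)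
  have "mass e = mass (eta H \<diamondop> e)" by (simp add: mass_conv)
  also have "\<dots> = 1" using e by (simp add: E_bullet_def)
  finally have "e \<diamondop> eta H = eta H"
    using conv_eta_H_supported[OF H_coset, of e] by (simp add: eproj)
  then have "e \<diamondop> (\<one>\<^bsub>A\<^esub> \<ominus>\<^bsub>A\<^esub> eta H) = e \<ominus>\<^bsub>A\<^esub> eta H"
    using eA by (simp add: a_minus_def A.r_distr A.r_minus)
  then show ?thesis by (simp add: defect_def)
qed

text \<open>
  For a generator \<open>e \<in> L\<close> in \<open>E\<^sup>\<bullet>(H)\<close> the second defining equation is the vanishing of the
  defect at \<open>e\<close>, which spreads to \<open>L = \<complex>[G]e\<close> because the defect is left linear.  The first
  equation restates \<open>L w \<subseteq> L\<close>.
\<close>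
lemma lumps_weakly_stable_iff:
  assumes GL: "gurvits_ledoux_ideal G H w L"
  shows "lumps_weakly_stable G H w L \<longleftrightarrow> (\<forall>x\<in>L. defect (weight_elt G w) x = (\<lambda>_. 0))"
proof
  let ?v = "weight_elt G w"
  assume "lumps_weakly_stable G H w L"
  then obtain e where e: "e \<in> E_bullet G H" "L = {x \<diamondop> e | x. x \<in> carrier A}"
      "(e \<ominus>\<^bsub>A\<^esub> eta H) \<diamondop> ?v \<diamondop> eta H = \<zero>\<^bsub>A\<^esub>"
    by (auto simp: lumps_weakly_stable_def Let_def)
  have eA: "e \<in> carrier A" using e(1) by (rule E_bullet_mem_A)
  have "defect ?v e = (\<lambda>_. 0)" using e(3) by (simp add: defect_E_bullet[OF e(1)] zero_A)
  moreover have "defect ?v (x \<diamondop> e) = x \<diamondop> defect ?v e" if "x \<in> carrier A" for x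
    using that eA by (simp add: defect_def A.m_assoc)
  moreover have "x \<diamondop> (\<lambda>_. 0) = (\<lambda>_. 0)" for x
    by (simp add: conv_apply fun_eq_iff)
  ultimately show "\<forall>x\<in>L. defect ?v x = (\<lambda>_. 0)"
    using e(2) by auto
next
  let ?v = "weight_elt G w"
  assume def: "\<forall>x\<in>L. defect ?v x = (\<lambda>_. 0)"
  have ind: "induced_left_ideal G H L" and etaG: "eta (carrier G) \<in> L"
    and step: "\<And>x. x \<in> L \<Longrightarrow> x \<diamondop> ?v \<in> L"
    using GL by (auto simp: gurvits_ledoux_ideal_def)
  note LA = induced_left_idealD(1)[OF ind] and lin = induced_left_idealD(2)[OF ind]
    and mult = induced_left_idealD(4)[OF ind]
  obtain e where e: "e \<in> L" "\<And>g. g \<notin> H \<Longrightarrow> e g = 0" "\<And>x. x \<in> L \<Longrightarrow> x \<diamondop> e = x"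
    using induced_ideal_idempotent[OF ind] by metis
  have eA: "e \<in> carrier A" using e(1) LA by blast
  \<comment> \<open>\<open>\<eta>\<^sub>H\<close> is a multiple of \<open>\<pi>\<^sub>H \<eta>\<^sub>G\<close>; as an element of \<open>L\<close> it is fixed by \<open>e\<close>.\<close>
  have "(\<lambda>g. 0 + of_nat (card (carrier G)) / of_nat (card H) * proj H (eta (carrier G)) g) \<in> L"
    using linear_subspaceD[OF lin] induced_ideal_proj_coset[OF ind etaG H_coset] by blast
  also have "(\<lambda>g. 0 + of_nat (card (carrier G)) / of_nat (card H) * proj H (eta (carrier G)) g) = eta H"
    using card_G_pos H.subset by (auto simp: proj_def eta_def fun_eq_iff)
  finally have etaH: "eta H \<in> L" .
  have E: "e \<in> E_bullet G H" using e etaH by (auto simp: E_bullet_def)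
  have "(e \<ominus>\<^bsub>A\<^esub> eta H) \<diamondop> ?v \<diamondop> eta H = \<zero>\<^bsub>A\<^esub>"
    using def e(1) by (simp add: defect_E_bullet[OF E, symmetric] zero_A)
  moreover have "e \<diamondop> ?v \<diamondop> (\<one>\<^bsub>A\<^esub> \<ominus>\<^bsub>A\<^esub> e) = \<zero>\<^bsub>A\<^esub>"
  proof -
    have "e \<diamondop> ?v \<diamondop> (\<one>\<^bsub>A\<^esub> \<ominus>\<^bsub>A\<^esub> e) = e \<diamondop> ?v \<ominus>\<^bsub>A\<^esub> e \<diamondop> ?v \<diamondop> e"
      using eA by (simp add: a_minus_def A.r_distr A.r_minus)
    also have "\<dots> = \<zero>\<^bsub>A\<^esub>" using e(3)[OF step[OF e(1)]] by (simp add: A.r_neg a_minus_def)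
    finally show ?thesis .
  qed
  moreover have "L = {x \<diamondop> e | x. x \<in> carrier A}"
  proof -
    have "\<exists>y\<in>carrier A. x = y \<diamondop> e" if "x \<in> L" for x using e(3)[OF that] that LA by force
    then show ?thesis using mult[OF _ e(1)] by blast
  qed
  ultimately show "lumps_weakly_stable G H w L"
    using E unfolding lumps_weakly_stable_def Let_def by blast
qed

section \<open>Irreducibility and the uniform distribution\<close>

text \<open>
  The Dirichlet form of the walk.  Right translations are unitary, so the two square terms of
  the expansion contribute equally.
\<close>
lemma dirichlet_form:
  fixes p :: "'a \<Rightarrow> complex" and w :: "'a \<Rightarrow> real"
  shows "(\<Sum>g\<in>carrier G. \<Sum>s\<in>carrier G. w s * (cmod (p g - p (g \<otimes> inv s)))\<^sup>2) =
    2 * Re (\<Sum>g\<in>carrier G. (mass (weight_elt G w) * p g - (p \<diamondop> weight_elt G w) g) * cnj (p g))"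
proof -
  let ?v = "weight_elt G w"
  have v: "?v s = of_real (w s)" if "s \<in> carrier G" for s using that by (simp add: weight_elt_def)
  define W where "W = (\<Sum>s\<in>carrier G. w s)"
  define N where "N = (\<Sum>g\<in>carrier G. (cmod (p g))\<^sup>2)"
  have mv: "mass ?v = of_real W" by (simp add: mass_def W_def v)
  have expand: "(cmod (a - b))\<^sup>2 = (cmod a)\<^sup>2 + (cmod b)\<^sup>2 - 2 * Re (b * cnj a)" for a b
    by (simp add: cmod_power2) (simp add: power2_eq_square algebra_simps)
  have shift: "(\<Sum>g\<in>carrier G. (cmod (p (g \<otimes> inv s)))\<^sup>2) = N" if "s \<in> carrier G" for s
    unfolding N_def
    by (rule sum.reindex_bij_witness[where i = "\<lambda>g. g \<otimes> s" and j = "\<lambda>g. g \<otimes> inv s"])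
      (use that in auto)
  have cross: "(\<Sum>s\<in>carrier G. w s * Re (p (g \<otimes> inv s) * cnj (p g))) = Re ((p \<diamondop> ?v) g * cnj (p g))"
    if g: "g \<in> carrier G" for g
    unfolding conv_apply_right[OF g] sum_distrib_right Re_sum
    by (intro sum.cong refl) (simp add: v algebra_simps)
  have "(\<Sum>g\<in>carrier G. \<Sum>s\<in>carrier G. w s * (cmod (p g - p (g \<otimes> inv s)))\<^sup>2) =
      (\<Sum>g\<in>carrier G. W * (cmod (p g))\<^sup>2) +
      (\<Sum>g\<in>carrier G. \<Sum>s\<in>carrier G. w s * (cmod (p (g \<otimes> inv s)))\<^sup>2) -
      2 * (\<Sum>g\<in>carrier G. \<Sum>s\<in>carrier G. w s * Re (p (g \<otimes> inv s) * cnj (p g)))"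
    unfolding expand
    by (simp add: W_def algebra_simps sum.distrib sum_subtractf sum_distrib_left sum_distrib_right)
  also have "(\<Sum>g\<in>carrier G. \<Sum>s\<in>carrier G. w s * (cmod (p (g \<otimes> inv s)))\<^sup>2) = W * N"
    by (subst sum.swap) (simp add: sum_distrib_left[symmetric] shift W_def sum_distrib_right)
  also have "(\<Sum>g\<in>carrier G. W * (cmod (p g))\<^sup>2) = W * N"
    by (simp add: N_def sum_distrib_left)
  also have "(\<Sum>g\<in>carrier G. \<Sum>s\<in>carrier G. w s * Re (p (g \<otimes> inv s) * cnj (p g))) =
      Re (\<Sum>g\<in>carrier G. (p \<diamondop> ?v) g * cnj (p g))"
    using cross by simp
  also have "W * N = Re (\<Sum>g\<in>carrier G. mass ?v * p g * cnj (p g))"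
  proof -
    have "Re (mass ?v * p g * cnj (p g)) = W * (cmod (p g))\<^sup>2" for g
      by (simp add: mv cmod_power2) (simp add: power2_eq_square algebra_simps)
    then show ?thesis by (simp add: N_def sum_distrib_left)
  qed
  finally show ?thesis
    by (simp add: left_diff_distrib sum_subtractf)
qed

text \<open>
  This replaces convergence to the uniform distribution.  Let \<open>p\<close> be the orthogonal projection
  of \<open>\<eta>\<^sub>G\<close> to \<open>V\<close>.  The element \<open>y = pw - w(G)p\<close> of \<open>V\<close> has mass 0, hence is orthogonal to \<open>\<eta>\<^sub>G\<close>, and
  it is orthogonal to \<open>\<eta>\<^sub>G - p\<close> because it lies in \<open>V\<close>.
  So \<open>\<langle>p, y\<rangle> = 0\<close>, the Dirichlet form of \<open>p\<close> vanishes,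
  and irreducibility makes \<open>p\<close> constant.  Testing \<open>\<eta>\<^sub>G - p\<close> against \<open>a\<close> finds the constant.
\<close>
lemma eta_in_invariant_subspace:
  assumes w: "irreducible_weight G w"
    and V: "linear_subspace V" "V \<subseteq> carrier A" "\<And>x. x \<in> V \<Longrightarrow> x \<diamondop> weight_elt G w \<in> V"
    and a: "a \<in> V" "mass a \<noteq> 0"
  shows "eta (carrier G) \<in> V"
proof -
  let ?v = "weight_elt G w" and ?n = "of_nat (card (carrier G)) :: complex"
  have supp: "\<forall>x\<in>V. \<forall>g. g \<notin> carrier G \<longrightarrow> x g = 0"
    using V(2) by (auto simp: mem_A_iff)
  obtain p where p: "p \<in> V"
    "\<forall>y\<in>V. (\<Sum>g\<in>carrier G. (eta (carrier G) g - p g) * cnj (y g)) = 0"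
    using orthogonal_projection_exists[OF finite_carrier V(1) supp, of "eta (carrier G)"] by (rule bexE)
  have ip: "(\<Sum>g\<in>carrier G. (eta (carrier G) g - q g) * cnj (y g)) =
      cnj (mass y) / ?n - (\<Sum>g\<in>carrier G. q g * cnj (y g))" for y q
    by (simp add: eta_def mass_def left_diff_distrib sum_subtractf sum_divide_distrib)
  define y where "y = (\<lambda>g. (p \<diamondop> ?v) g + (- mass ?v) * p g)"
  have yV: "y \<in> V" unfolding y_def by (rule linear_subspaceD(2)[OF V(1) V(3)[OF p(1)] p(1)])
  have "mass y = 0" unfolding y_def mass_linear mass_conv by simp
  then have "(\<Sum>g\<in>carrier G. p g * cnj (y g)) = 0"
    using bspec[OF p(2) yV] unfolding ip by simp
  then have "cnj (\<Sum>g\<in>carrier G. p g * cnj (y g)) = 0" by simp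
  then have "(\<Sum>g\<in>carrier G. y g * cnj (p g)) = 0" by (simp add: mult.commute)
  moreover have "(\<Sum>g\<in>carrier G. (mass ?v * p g - (p \<diamondop> ?v) g) * cnj (p g)) =
      - (\<Sum>g\<in>carrier G. y g * cnj (p g))"
    unfolding sum_negf[symmetric] y_def by (intro sum.cong refl) (simp add: algebra_simps)
  ultimately have zero: "(\<Sum>g\<in>carrier G. \<Sum>s\<in>carrier G. w s * (cmod (p g - p (g \<otimes> inv s)))\<^sup>2) = 0"
    unfolding dirichlet_form by simp
  have w0: "w s \<ge> 0" if "s \<in> carrier G" for s
    using w that by (auto simp: irreducible_weight_def weight_def)
  have p_inv: "p (g \<otimes> inv s) = p g" if "g \<in> carrier G" "s \<in> carrier G" "w s \<noteq> 0" for g s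
  proof -
    have "(\<Sum>s\<in>carrier G. w s * (cmod (p g - p (g \<otimes> inv s)))\<^sup>2) = 0"
      using zero that(1) w0 finite_carrier by (simp add: sum_nonneg_eq_0_iff sum_nonneg)
    then have "w s * (cmod (p g - p (g \<otimes> inv s)))\<^sup>2 = 0"
      using that(2) w0 finite_carrier by (simp add: sum_nonneg_eq_0_iff)
    then show ?thesis using that(3) by simp
  qed
  have const: "\<forall>g\<in>carrier G. p (g \<otimes> k) = p g"
    if "k \<in> generate G {g \<in> carrier G. w g \<noteq> 0}" for k
    using that
  proof (induction rule: generate.induct)
    case (incl s)
    then show ?case using p_inv[of "_ \<otimes> s" s] by force
  next
    case (eng h1 h2)
    have "h1 \<in> carrier G" "h2 \<in> carrier G"
      using eng.hyps w by (auto simp: irreducible_weight_def)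
    then show ?case using eng.IH by (auto simp: m_assoc[symmetric])
  qed (use p_inv in auto)
  have p1: "p g = p \<one>" if "g \<in> carrier G" for g
  proof -
    have "\<forall>h\<in>carrier G. p (h \<otimes> g) = p h"
      using const[of g] that w by (simp add: irreducible_weight_def)
    then have "p (\<one> \<otimes> g) = p \<one>" by blast
    then show ?thesis using that by simp
  qed
  have "(\<Sum>g\<in>carrier G. p g * cnj (a g)) = p \<one> * cnj (mass a)"
    unfolding mass_def cnj_sum sum_distrib_left using p1 by (intro sum.cong refl) metis
  then have "cnj (mass a) / ?n = p \<one> * cnj (mass a)" using bspec[OF p(2) a(1)] unfolding ip by simp
  then have "p \<one> * cnj (mass a) = 1 / ?n * cnj (mass a)" by simp
  moreover have "cnj (mass a) \<noteq> 0" using a(2) by simp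
  ultimately have "p \<one> = 1 / ?n" by (metis mult_right_cancel)
  then have "p g = eta (carrier G) g" for g
    using p1[of g] supp p(1) by (cases "g \<in> carrier G") (auto simp: eta_def)
  then have "p = eta (carrier G)" by blast
  then show ?thesis using p(1) by simp
qed

section \<open>The law of the lumped walk\<close>

text \<open>
  One step of the walk is a convolution with \<open>w\<close>, and observing a coset is a projection.
\<close>
lemma random_walk_law:
  assumes rw: "random_walk G \<alpha> w M X"
    and c: "\<And>i. i < t \<Longrightarrow> c i \<in> cosets" and g: "g \<in> carrier G"
  shows "complex_of_real \<P>(\<omega> in M. X t \<omega> = g \<and> (\<forall>i<t. X i \<omega> \<in> c i)) =
     walk (weight_elt G w) (weight_elt G \<alpha>) (map c [0..<t]) g / mass (weight_elt G w) ^ t"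
  using c g
proof (induction t arbitrary: g)
  case 0
  then show ?case using rw by (simp add: random_walk_def weight_elt_def)
next
  case (Suc t)
  let ?v = "weight_elt G w" and ?W = "\<Sum>g\<in>carrier G. w g"
  let ?y = "walk ?v (weight_elt G \<alpha>) (map c [0..<t])"
  have mc: "markov_chain M (carrier G) (\<lambda>x y. w (inv x \<otimes> y) / ?W) X"
    using rw by (simp add: random_walk_def)
  interpret prob_space M using mc by (simp add: markov_chain_def)
  have X: "\<And>t. X t \<in> measurable M (count_space (carrier G))"
    using mc by (simp add: markov_chain_def)
  have mv: "mass ?v = complex_of_real ?W" by (simp add: mass_def weight_elt_def)
  have ct: "finite (c t)" "c t \<subseteq> carrier G" "c t \<in> cosets"
    using Suc.prems(1)[of t] finite_coset coset_subset by auto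
  let ?R = "\<lambda>\<omega>. X (Suc t) \<omega> = g \<and> (\<forall>i<t. X i \<omega> \<in> c i)"
  have "{\<omega> \<in> space M. X (Suc t) \<omega> \<in> {g}} \<inter> {\<omega> \<in> space M. \<forall>i\<in>{..<t}. X i \<omega> \<in> c i} \<in> sets M"
    using Suc.prems coset_subset
    by (intro sets.Int sets.sets_Collect_finite_All measurable_event[OF X]) auto
  also have "{\<omega> \<in> space M. X (Suc t) \<omega> \<in> {g}} \<inter> {\<omega> \<in> space M. \<forall>i\<in>{..<t}. X i \<omega> \<in> c i} =
      {\<omega> \<in> space M. ?R \<omega>}" by auto
  finally have R: "{\<omega> \<in> space M. ?R \<omega>} \<in> sets M" .
  have step: "complex_of_real \<P>(\<omega> in M. X t \<omega> = h \<and> ?R \<omega>) =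
      ?y h * ?v (inv h \<otimes> g) / mass ?v ^ Suc t" if h: "h \<in> c t" for h
  proof -
    have hG: "h \<in> carrier G" using h ct by blast
    have sing: "(\<forall>i\<le>t. X i \<omega> \<in> (c(t := {h})) i) \<longleftrightarrow> X t \<omega> = h \<and> (\<forall>i<t. X i \<omega> \<in> c i)" for \<omega>
      by (auto simp: le_less)
    have "\<P>(\<omega> in M. X (Suc t) \<omega> = g \<and> (\<forall>i\<le>t. X i \<omega> \<in> (c(t := {h})) i)) =
       w (inv h \<otimes> g) / ?W * \<P>(\<omega> in M. \<forall>i\<le>t. X i \<omega> \<in> (c(t := {h})) i)"
      using Suc.prems coset_subset hG
      by (intro markov_chain_coarse_past[OF mc finite_carrier]) auto
    then have "\<P>(\<omega> in M. X t \<omega> = h \<and> ?R \<omega>) =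
        w (inv h \<otimes> g) / ?W * \<P>(\<omega> in M. X t \<omega> = h \<and> (\<forall>i<t. X i \<omega> \<in> c i))"
      unfolding sing by (simp only: conj_left_commute)
    then have "complex_of_real \<P>(\<omega> in M. X t \<omega> = h \<and> ?R \<omega>) =
        of_real (w (inv h \<otimes> g)) / mass ?v * (?y h / mass ?v ^ t)"
      using Suc.IH[OF _ hG] Suc.prems(1) by (simp add: mv)
    then show ?thesis using hG Suc.prems(2) by (simp add: weight_elt_def)
  qed
  have "\<P>(\<omega> in M. X (Suc t) \<omega> = g \<and> (\<forall>i<Suc t. X i \<omega> \<in> c i)) =
      \<P>(\<omega> in M. X t \<omega> \<in> c t \<and> ?R \<omega>)"
    by (rule arg_cong[where f = prob]) (auto simp: less_Suc_eq)
  also have "\<dots> = (\<Sum>h\<in>c t. \<P>(\<omega> in M. X t \<omega> = h \<and> ?R \<omega>))"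
    by (rule prob_split[OF prob_space_axioms X ct(1,2) R])
  finally have "complex_of_real \<P>(\<omega> in M. X (Suc t) \<omega> = g \<and> (\<forall>i<Suc t. X i \<omega> \<in> c i)) =
      (\<Sum>h\<in>c t. ?y h * ?v (inv h \<otimes> g)) / mass ?v ^ Suc t"
    by (simp only: of_real_sum sum_divide_distrib) (intro sum.cong refl step)
  also have "(\<Sum>h\<in>c t. ?y h * ?v (inv h \<otimes> g)) = (proj (c t) ?y \<diamondop> ?v) g"
  proof -
    have "(\<Sum>h\<in>c t. ?y h * ?v (inv h \<otimes> g)) = (\<Sum>h\<in>carrier G. proj (c t) ?y h * ?v (inv h \<otimes> g))"
      by (rule sum.mono_neutral_cong_left) (use ct finite_carrier in \<open>auto simp: proj_def\<close>)
    then show ?thesis using Suc.prems(2) by (simp add: conv_apply)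
  qed
  finally show ?case by simp
qed

lemma lumped_walk_law:
  assumes rw: "random_walk G \<alpha> w M X" and c: "\<And>i. i \<le> t \<Longrightarrow> c i \<in> cosets"
  shows "complex_of_real \<P>(\<omega> in M. \<forall>i\<le>t. X i \<omega> <# H = c i) =
     mass (proj (c t) (walk (weight_elt G w) (weight_elt G \<alpha>) (map c [0..<t]))) /
       mass (weight_elt G w) ^ t"
proof -
  have mc: "markov_chain M (carrier G) (\<lambda>x y. w (inv x \<otimes> y) / (\<Sum>g\<in>carrier G. w g)) X"
    using rw by (simp add: random_walk_def)
  interpret prob_space M using mc by (simp add: markov_chain_def)
  have X: "\<And>t. X t \<in> measurable M (count_space (carrier G))"
    using mc by (simp add: markov_chain_def)
  have ct: "finite (c t)" "c t \<subseteq> carrier G" "c t \<in> cosets"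
    using c[of t] finite_coset coset_subset by auto
  have "{\<omega> \<in> space M. \<forall>i\<in>{..<t}. X i \<omega> \<in> c i} \<in> sets M"
    using c coset_subset
    by (intro sets.sets_Collect_finite_All measurable_event[OF X]) auto
  then have R: "{\<omega> \<in> space M. \<forall>i<t. X i \<omega> \<in> c i} \<in> sets M" by (simp only: Ball_def lessThan_iff)
  have "X i \<omega> <# H = c i \<longleftrightarrow> X i \<omega> \<in> c i" if "\<omega> \<in> space M" "i \<le> t" for i \<omega>
    using measurable_space[OF X that(1)] c[OF that(2)] by (intro lcoset_eq_iff) auto
  then have "{\<omega> \<in> space M. \<forall>i\<le>t. X i \<omega> <# H = c i} =
      {\<omega> \<in> space M. X t \<omega> \<in> c t \<and> (\<forall>i<t. X i \<omega> \<in> c i)}"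
    by (auto simp: le_less)
  then have "complex_of_real \<P>(\<omega> in M. \<forall>i\<le>t. X i \<omega> <# H = c i) =
      (\<Sum>h\<in>c t. complex_of_real \<P>(\<omega> in M. X t \<omega> = h \<and> (\<forall>i<t. X i \<omega> \<in> c i)))"
    by (simp add: prob_split[OF prob_space_axioms X ct(1,2) R])
  also have "\<dots> = (\<Sum>h\<in>c t. walk (weight_elt G w) (weight_elt G \<alpha>) (map c [0..<t]) h /
      mass (weight_elt G w) ^ t)"
    using c ct by (intro sum.cong refl random_walk_law[OF rw]) auto
  finally show ?thesis by (simp add: mass_proj[OF ct(3)] sum_divide_distrib)
qed

text \<open>
  Started from \<open>x\<close>, the lumped walk has transition matrix \<open>Q\<close>, with probabilities multiplied out
  so that the condition is linear in \<open>x\<close> and makes sense for complex \<open>x\<close>.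
\<close>
definition transition_law ::
  "('a \<Rightarrow> complex) \<Rightarrow> ('a set \<Rightarrow> 'a set \<Rightarrow> real) \<Rightarrow> ('a \<Rightarrow> complex) \<Rightarrow> bool" where
  "transition_law v Q x \<longleftrightarrow> (\<forall>Cs C D. set Cs \<subseteq> cosets \<longrightarrow> C \<in> cosets \<longrightarrow> D \<in> cosets \<longrightarrow>
     mass (proj D (proj C (walk v x Cs) \<diamondop> v)) = mass v * of_real (Q C D) * mass (proj C (walk v x Cs)))"

text \<open>
  The defining condition of a Markov chain is restricted to coset paths of positive probability.
  On the other paths the multiplied-out condition reads \<open>0 = 0\<close>, so it may be demanded for all.
\<close>
lemma lumped_markov_iff:
  assumes rw: "random_walk G \<alpha> w M X" and w: "weight G w"
  shows "lumped_markov G H M X \<longleftrightarrow>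
     (\<exists>Q. (\<forall>C\<in>cosets. distribution_on cosets (Q C)) \<and>
        transition_law (weight_elt G w) Q (weight_elt G \<alpha>))"
proof -
  let ?v = "weight_elt G w" and ?a = "weight_elt G \<alpha>"
  have mc: "markov_chain M (carrier G) (\<lambda>x y. w (inv x \<otimes> y) / (\<Sum>g\<in>carrier G. w g)) X"
    using rw by (simp add: random_walk_def)
  interpret prob_space M using mc by (simp add: markov_chain_def)
  have X: "\<And>t. X t \<in> measurable M (count_space (carrier G))"
    using mc by (simp add: markov_chain_def)
  have Y: "(\<lambda>\<omega>. X t \<omega> <# H) \<in> measurable M (count_space cosets)" for t
    by (rule measurable_compose[OF X]) (auto intro: lcosets_memI)
  have W: "mass ?v \<noteq> 0" using mass_weight_pos[OF w] unfolding mass_weight_elt of_real_eq_0_iff by simp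
  let ?path = "\<lambda>c t. \<P>(\<omega> in M. \<forall>i\<le>t. X i \<omega> <# H = c i)"
  let ?next = "\<lambda>c t D. \<P>(\<omega> in M. X (Suc t) \<omega> <# H = D \<and> (\<forall>i\<le>t. X i \<omega> <# H = c i))"
  have pathE: "complex_of_real (?path c t) = mass (proj (c t) (walk ?v ?a (map c [0..<t]))) / mass ?v ^ t"
    if "\<forall>i\<le>t. c i \<in> cosets" for c t
    using that by (intro lumped_walk_law[OF rw]) auto
  have nextE: "complex_of_real (?next c t D) =
      mass (proj D (proj (c t) (walk ?v ?a (map c [0..<t])) \<diamondop> ?v)) / mass ?v ^ Suc t"
    if c: "\<forall>i\<le>t. c i \<in> cosets" and D: "D \<in> cosets" for c t D
  proof -
    have "?next c t D = ?path (c(Suc t := D)) (Suc t)"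
      by (rule arg_cong[where f = prob]) (auto simp: le_Suc_eq)
    moreover have "complex_of_real (?path (c(Suc t := D)) (Suc t)) =
        mass (proj D (walk ?v ?a (map (c(Suc t := D)) [0..<Suc t]))) / mass ?v ^ Suc t"
      using pathE[of "Suc t" "c(Suc t := D)"] c D by simp
    moreover have "map (c(Suc t := D)) [0..<Suc t] = map c [0..<t] @ [c t]" by simp
    ultimately show ?thesis by (simp only: walk_simps)
  qed
  have law_iff: "?next c t D = Q (c t) D * ?path c t \<longleftrightarrow>
      mass (proj D (proj (c t) (walk ?v ?a (map c [0..<t])) \<diamondop> ?v)) =
      mass ?v * of_real (Q (c t) D) * mass (proj (c t) (walk ?v ?a (map c [0..<t])))"
    if c: "\<forall>i\<le>t. c i \<in> cosets" and D: "D \<in> cosets" for c D Q and t :: nat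
  proof -
    have "?next c t D = Q (c t) D * ?path c t \<longleftrightarrow>
        complex_of_real (?next c t D) = complex_of_real (Q (c t) D) * complex_of_real (?path c t)"
      by (simp only: of_real_mult[symmetric] of_real_eq_iff)
    then show ?thesis
      unfolding nextE[OF c D] pathE[OF c] using W by (simp add: field_simps)
  qed
  have chain_iff: "markov_chain M cosets Q (\<lambda>t \<omega>. X t \<omega> <# H) \<longleftrightarrow>
      (\<forall>C\<in>cosets. distribution_on cosets (Q C)) \<and>
      (\<forall>t c D. (\<forall>i\<le>t. c i \<in> cosets) \<longrightarrow> D \<in> cosets \<longrightarrow> ?next c t D = Q (c t) D * ?path c t)" for Q
  proof -
    have "(?path c t \<noteq> 0 \<longrightarrow>
        \<P>(\<omega> in M. X (Suc t) \<omega> <# H = D \<bar> \<forall>i\<le>t. X i \<omega> <# H = c i) = Q (c t) D) \<longleftrightarrow>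
        ?next c t D = Q (c t) D * ?path c t"
      if c: "\<forall>i\<le>t. c i \<in> cosets" for c t D
    proof (cases "?path c t = 0")
      case True
      have "?next c t D \<le> ?path c t"
        using c by (intro finite_measure_mono path_event_sets[OF Y]) auto
      then show ?thesis using True by (simp add: measure_le_0_iff)
    next
      case False
      then show ?thesis by (simp add: cond_prob_def nonzero_divide_eq_eq)
    qed
    then show ?thesis
      unfolding markov_chain_def using prob_space_axioms Y by meson
  qed
  have "(\<forall>(t::nat) c D. (\<forall>i\<le>t. c i \<in> cosets) \<longrightarrow> D \<in> cosets \<longrightarrow> ?next c t D = Q (c t) D * ?path c t) \<longleftrightarrow>
      transition_law ?v Q ?a" for Q
  proof
    assume l: "\<forall>(t::nat) c D. (\<forall>i\<le>t. c i \<in> cosets) \<longrightarrow> D \<in> cosets \<longrightarrow> ?next c t D = Q (c t) D * ?path c t"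
    show "transition_law ?v Q ?a"
      unfolding transition_law_def
    proof (intro allI impI)
      fix Cs C D assume Cs: "set Cs \<subseteq> cosets" and C: "C \<in> cosets" and D: "D \<in> cosets"
      \<comment> \<open>Only the values of \<open>c\<close> up to \<open>length Cs\<close> matter.\<close>
      define c where "c = (\<lambda>i. (Cs @ [C]) ! i)"
      have c: "\<forall>i\<le>length Cs. c i \<in> cosets"
      proof (intro allI impI)
        fix i assume "i \<le> length Cs"
        then have "c i \<in> set (Cs @ [C])" unfolding c_def by (intro nth_mem) simp
        then show "c i \<in> cosets" using Cs C by auto
      qed
      have "map c [0..<length Cs] = Cs" "c (length Cs) = C"
        by (auto simp: c_def intro: nth_equalityI simp: nth_append)
      then show "mass (proj D (proj C (walk ?v ?a Cs) \<diamondop> ?v)) =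
          mass ?v * of_real (Q C D) * mass (proj C (walk ?v ?a Cs))"
        using l c D law_iff[OF c D, of Q] by simp
    qed
  next
    assume l: "transition_law ?v Q ?a"
    show "\<forall>(t::nat) c D. (\<forall>i\<le>t. c i \<in> cosets) \<longrightarrow> D \<in> cosets \<longrightarrow> ?next c t D = Q (c t) D * ?path c t"
    proof (intro allI impI)
      fix t :: nat and c D assume c: "\<forall>i\<le>t. c i \<in> cosets" and D: "D \<in> cosets"
      have "set (map c [0..<(t::nat)]) \<subseteq> cosets" "c t \<in> cosets" using c by auto
      then show "?next c t D = Q (c t) D * ?path c t"
        using l D unfolding law_iff[OF c D] transition_law_def by blast
    qed
  qed
  then show ?thesis unfolding lumped_markov_def chain_iff by blast
qed

lemma transition_law_subspace: "linear_subspace {x \<in> carrier A. transition_law v Q x}"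
  by (auto simp: linear_subspace_def mem_A_iff transition_law_def walk_linear proj_linear
      conv_linear_left mass_linear algebra_simps)

lemma transition_law_step:
  assumes x: "x \<in> carrier A" and l: "transition_law v Q x"
  shows "transition_law v Q (x \<diamondop> v)"
  unfolding transition_law_def
proof (intro allI impI)
  fix Cs C D assume *: "set Cs \<subseteq> cosets" "C \<in> cosets" "D \<in> cosets"
  have "mass (proj D (proj C (walk v x (B # Cs)) \<diamondop> v)) =
      mass v * of_real (Q C D) * mass (proj C (walk v x (B # Cs)))" if B: "B \<in> cosets" for B
  proof -
    have "set (B # Cs) \<subseteq> cosets" using B * by simp
    then show ?thesis using l * unfolding transition_law_def by blast
  qed
  then show "mass (proj D (proj C (walk v (x \<diamondop> v) Cs) \<diamondop> v)) =
      mass v * of_real (Q C D) * mass (proj C (walk v (x \<diamondop> v) Cs))"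
    unfolding walk_step[OF x] proj_sum conv_sum_left mass_sum sum_distrib_left
    by (rule sum.cong[OF refl])
qed

section \<open>Weak lumping from the uniform distribution\<close>

lemma eta_lumpable_iff:
  assumes v: "v \<in> carrier A"
  shows "eta (carrier G) \<in> lumpable_elements v \<longleftrightarrow>
     (\<forall>Cs C D. set Cs \<subseteq> cosets \<longrightarrow> C \<in> cosets \<longrightarrow> D \<in> cosets \<longrightarrow>
       mass (proj D (proj C (walk v (eta (carrier G)) Cs) \<diamondop> v)) =
       mass (proj C (walk v (eta (carrier G)) Cs)) * mass (proj D (eta C \<diamondop> v)))"
  using eta_mem_A[of "carrier G"]
  by (auto simp: lumpable_elements_def defect_proj_eq_zero_iff walk_mem_A v)

text \<open>
  For a fixed \<open>Q\<close> the elements with transition law \<open>Q\<close> form a subspace closed under \<open>w\<close>.  It contains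
  the given initial distribution, hence \<open>\<eta>\<^sub>G\<close>.  From \<open>\<eta>\<^sub>G\<close> the first step out of \<open>C\<close> starts from a
  multiple of \<open>\<eta>\<^sub>C\<close>, which identifies \<open>Q\<close> as the matrix that the vanishing of the defect asks for.
\<close>
lemma walk_lumps_imp_lumpable:
  assumes w: "irreducible_weight G w" and lump: "walk_lumps_weakly G H w"
  shows "eta (carrier G) \<in> lumpable_elements (weight_elt G w)"
proof -
  let ?v = "weight_elt G w" and ?u = "eta (carrier G) :: 'a \<Rightarrow> complex"
  have wt: "weight G w" using w by (simp add: irreducible_weight_def)
  obtain \<alpha> where \<alpha>: "distribution_on (carrier G) \<alpha>" "lumps_weakly G H \<alpha> w"
    using lump by (auto simp: walk_lumps_weakly_def)
  obtain M :: "(nat \<Rightarrow> 'a) measure" and X where rw: "random_walk G \<alpha> w M X"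
    using random_walk_exists[OF is_group finite_carrier wt \<alpha>(1)] by blast
  then have "lumped_markov G H M X" using \<alpha>(2) by (simp add: lumps_weakly_def)
  then obtain Q where Q: "transition_law ?v Q (weight_elt G \<alpha>)"
    using lumped_markov_iff[OF rw wt] by blast
  have "mass (weight_elt G \<alpha>) \<noteq> 0"
    using \<alpha>(1) by (simp add: mass_weight_elt distribution_on_def)
  then have "?u \<in> {x \<in> carrier A. transition_law ?v Q x}"
    by (intro eta_in_invariant_subspace[OF w transition_law_subspace, of _ _ "weight_elt G \<alpha>"])
      (auto simp: Q transition_law_step)
  then have law: "transition_law ?v Q ?u" by simp
  have Qeq: "mass ?v * of_real (Q C D) = mass (proj D (eta C \<diamondop> ?v))"
    if C: "C \<in> cosets" and D: "D \<in> cosets" for C D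
  proof -
    define r where "r = (of_nat (card H) / of_nat (card (carrier G)) :: complex)"
    have r: "r \<noteq> 0" using card_H_pos card_G_pos by (simp add: r_def)
    have "mass (proj D (proj C (walk ?v ?u []) \<diamondop> ?v)) =
        mass ?v * of_real (Q C D) * mass (proj C (walk ?v ?u []))"
      using law C D unfolding transition_law_def by (metis empty_subsetI list.set(1))
    then have "r * mass (proj D (eta C \<diamondop> ?v)) = r * (mass ?v * of_real (Q C D))"
      using C proj_linear[of D "\<lambda>_. 0"]
      by (simp add: proj_eta_carrier[folded r_def] conv_scale_left mass_scale mass_eta_coset)
    then show ?thesis using r by simp
  qed
  show ?thesis
    unfolding eta_lumpable_iff[OF weight_elt_mem_A]
    using law Qeq unfolding transition_law_def by (simp add: mult.commute)
qed

text \<open>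
  By the vanishing defect, every coset path leaves \<open>C\<close> as the uniform distribution on \<open>C\<close> does;
  that gives the transition matrix.
\<close>
lemma lumpable_imp_eta_lumps:
  assumes w: "weight G w" and eta: "eta (carrier G) \<in> lumpable_elements (weight_elt G w)"
  shows "lumps_weakly G H (eta (carrier G)) w"
  unfolding lumps_weakly_def
proof (intro allI impI)
  fix M :: "(nat \<Rightarrow> 'a) measure" and X
  assume rw: "random_walk G (eta (carrier G)) w M X"
  let ?v = "weight_elt G w" and ?W = "\<Sum>g\<in>carrier G. w g"
  define Q where "Q = (\<lambda>C D. (\<Sum>g\<in>D. \<Sum>h\<in>C. w (inv h \<otimes> g)) / (card H * ?W))"
  have W: "?W > 0" by (rule mass_weight_pos[OF w])
  then have mv: "mass ?v \<noteq> 0" unfolding mass_weight_elt of_real_eq_0_iff by simp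
  have Qeq: "complex_of_real (Q C D) = mass (proj D (eta C \<diamondop> ?v)) / mass ?v"
    if C: "C \<in> cosets" and D: "D \<in> cosets" for C D
  proof -
    have "(eta C \<diamondop> ?v) g = (\<Sum>h\<in>C. of_real (w (inv h \<otimes> g))) / of_nat (card H)" if g: "g \<in> D" for g
    proof -
      have gG: "g \<in> carrier G" using g coset_subset[OF D] by blast
      have "(\<Sum>h\<in>carrier G. eta C h * ?v (inv h \<otimes> g)) = (\<Sum>h\<in>C. of_real (w (inv h \<otimes> g)) / of_nat (card H))"
        by (rule sum.mono_neutral_cong_right)
          (use gG coset_subset[OF C] finite_carrier card_coset[OF C] in \<open>auto simp: eta_def weight_elt_def\<close>)
      then show ?thesis using gG by (simp add: conv_apply sum_divide_distrib)
    qed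
    then have "mass (proj D (eta C \<diamondop> ?v)) = (\<Sum>g\<in>D. \<Sum>h\<in>C. of_real (w (inv h \<otimes> g))) / of_nat (card H)"
      by (simp add: mass_proj[OF D] sum_divide_distrib)
    then show ?thesis by (simp add: Q_def mass_weight_elt)
  qed
  have dist: "distribution_on cosets (Q C)" if C: "C \<in> cosets" for C
  proof -
    have "Q C D \<ge> 0" if D: "D \<in> cosets" for D
    proof -
      have "w (inv h \<otimes> g) \<ge> 0" if "g \<in> D" "h \<in> C" for g h
      proof -
        have "inv h \<otimes> g \<in> carrier G"
          using that coset_subset[OF C] coset_subset[OF D] by blast
        then show ?thesis using w by (simp add: weight_def)
      qed
      then show ?thesis using W unfolding Q_def by (intro divide_nonneg_nonneg sum_nonneg) auto
    qed
    moreover have "complex_of_real (\<Sum>D\<in>cosets. Q C D) = 1"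
    proof -
      have "complex_of_real (\<Sum>D\<in>cosets. Q C D) = (\<Sum>D\<in>cosets. mass (proj D (eta C \<diamondop> ?v))) / mass ?v"
        using Qeq[OF C] by (simp add: sum_divide_distrib)
      also have "(\<Sum>D\<in>cosets. mass (proj D (eta C \<diamondop> ?v))) = mass (eta C \<diamondop> ?v)"
        unfolding mass_sum[symmetric] by (simp add: sum_proj_cosets)
      also have "\<dots> = mass ?v" using C by (simp add: mass_conv mass_eta_coset)
      finally show ?thesis using mv by simp
    qed
    ultimately show ?thesis by (simp only: distribution_on_def of_real_eq_1_iff) blast
  qed
  have "weight_elt G (eta (carrier G)) = eta (carrier G)"
    by (auto simp: weight_elt_def eta_def)
  moreover have "transition_law ?v Q (eta (carrier G))"
    using eta mv unfolding eta_lumpable_iff[OF weight_elt_mem_A] transition_law_def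
    by (simp add: Qeq mult.commute)
  ultimately show "lumped_markov G H M X"
    unfolding lumped_markov_iff[OF rw w] using dist by auto
qed

end

theorem corollary1p6:
  fixes G :: "('a, 'b) monoid_scheme" and H :: "'a set" and w :: "'a \<Rightarrow> real"
  assumes "group G" and "finite (carrier G)" and "subgroup H G"
    and "irreducible_weight G w"
  shows
    "let A = group_algebra G; L = minimal_GL_ideal G H w; v = weight_elt G w in
       (walk_lumps_weakly G H w \<longleftrightarrow> lumps_weakly G H (eta (carrier G)) w) \<and>
       (lumps_weakly G H (eta (carrier G)) w \<longleftrightarrow>
          (\<forall>x\<in>L. x \<otimes>\<^bsub>A\<^esub> (\<one>\<^bsub>A\<^esub> \<ominus>\<^bsub>A\<^esub> eta H) \<otimes>\<^bsub>A\<^esub> v \<otimes>\<^bsub>A\<^esub> eta H = \<zero>\<^bsub>A\<^esub>)) \<and>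
       (lumps_weakly G H (eta (carrier G)) w \<longleftrightarrow> lumps_weakly_stable G H w L)"
proof -
  interpret finite_group_subgroup G H
    using assms by (simp add: finite_group_subgroup_def finite_group_subgroup_axioms_def)
  let ?L = "minimal_GL_ideal G H w" and ?u = "eta (carrier G)"
  have w: "weight G w" using assms(4) by (simp add: irreducible_weight_def)
  have "distribution_on (carrier G) ?u"
    using assms(2) one_closed by (intro distribution_on_eta) auto
  then have "lumps_weakly G H ?u w \<Longrightarrow> walk_lumps_weakly G H w"
    by (auto simp: walk_lumps_weakly_def)
  then have "walk_lumps_weakly G H w \<longleftrightarrow> lumps_weakly G H ?u w"
    "lumps_weakly G H ?u w \<longleftrightarrow> ?u \<in> lumpable_elements (weight_elt G w)"
    using walk_lumps_imp_lumpable[OF assms(4)] lumpable_imp_eta_lumps[OF w] by blast+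
  then show ?thesis
    using minimal_GL_ideal_defect_iff[of w] lumps_weakly_stable_iff[OF minimal_GL_ideal_GL, of w]
    by (simp add: Let_def defect_def zero_A)
qed

end
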